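(* Let $(t_k)_{k\ge 0}$ be an increasing sequence of positive real numbers such that $t_0=1$ and $\frac{t_{k+1}}{t_k}\to+\infty$. Then there exist a separable complex Banach space $X$ and a $C_0$-semigroup $(T_t)_{t\ge 0}$ (with infinitesimal generator $A$) of bounded linear operators on $X$ which is bounded with respect to the sequence $(t_k)_{k\ge 0}$ and such that $\dim_H(\sigma_p(A)\cap i\mathbb{R})=1$.
   Context: $\sigma_p(A)$ denotes the point spectrum (set of eigenvalues) of $A$, and $\dim_H$ denotes Hausdorff dimension. A semigroup $(T_t)_{t\ge 0}$ is bounded with respect to $(t_k)_{k\ge 0}$ if $\sup_{k\ge 0}\|T_{t_k}\|<+\infty$. *)

theory Defs
  imports "HOL-Analysis.Analysis" "HOL-Algebra.Module"
begin

section \<open>Complex Banach spaces with an explicit carrier\<close>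

definition complex_ring :: "complex ring" where
  "complex_ring = \<lparr>carrier = UNIV, monoid.mult = (*), one = 1, ring.zero = 0, add = (+)\<rparr>"

text \<open>As for every module record, the fields for multiplication and unit inherited
  from rings play no role.\<close>

record 'v normed_module = "(complex, 'v) module" +
  vnorm :: "'v \<Rightarrow> real"

locale complex_normed_space = Module.module complex_ring X
  for X :: "('v, 'm) normed_module_scheme" (structure) +
  assumes vnorm_nonneg: "x \<in> carrier X \<Longrightarrow> 0 \<le> vnorm X x"
    and vnorm_eq_zero: "x \<in> carrier X \<Longrightarrow> vnorm X x = 0 \<longleftrightarrow> x = \<zero>"
    and vnorm_triangle:
      "\<lbrakk>x \<in> carrier X; y \<in> carrier X\<rbrakk> \<Longrightarrow> vnorm X (x \<oplus> y) \<le> vnorm X x + vnorm X y"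
    and vnorm_smult: "x \<in> carrier X \<Longrightarrow> vnorm X (c \<odot> x) = cmod c * vnorm X x"

text \<open>The value off the carrier is irrelevant; it is set to 0 because the locale
  \<^locale>\<open>Metric_space\<close> demands symmetry and nonnegativity on the whole type.\<close>

definition vdist :: "('v, 'm) normed_module_scheme \<Rightarrow> 'v \<Rightarrow> 'v \<Rightarrow> real" where
  "vdist X x y = (if x \<in> carrier X \<and> y \<in> carrier X then vnorm X (x \<ominus>\<^bsub>X\<^esub> y) else 0)"

abbreviation norm_topology :: "('v, 'm) normed_module_scheme \<Rightarrow> 'v topology" where
  "norm_topology X \<equiv> Metric_space.mtopology (carrier X) (vdist X)"

lemma cring_complex_ring: "cring complex_ring"
proof (rule cringI)
  show "abelian_group complex_ring"
  proof (rule abelian_groupI)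
    fix x assume "x \<in> carrier complex_ring"
    show "\<exists>y\<in>carrier complex_ring. y \<oplus>\<^bsub>complex_ring\<^esub> x = \<zero>\<^bsub>complex_ring\<^esub>"
      by (rule bexI[of _ "- x"]) (auto simp: complex_ring_def)
  qed (auto simp: complex_ring_def)
  show "comm_monoid complex_ring"
    by (rule comm_monoidI) (auto simp: complex_ring_def)
qed (auto simp: complex_ring_def algebra_simps)

lemma (in complex_normed_space) Metric_space_vdist: "Metric_space (carrier X) (vdist X)"
proof
  have minus: "\<ominus> x = (-1) \<odot> x" if "x \<in> carrier X" for x
  proof -
    have "(-1) \<odot> x \<oplus> x = (-1) \<odot> x \<oplus> 1 \<odot> x"
      using smult_one[OF that] by (simp add: complex_ring_def)
    also have "\<dots> = 0 \<odot> x"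
      using smult_l_distr[of "-1" 1 x] that by (simp add: complex_ring_def)
    also have "\<dots> = \<zero>"
      using smult_l_null[OF that] by (simp add: complex_ring_def)
    finally show ?thesis
      using that smult_closed[of "-1" x]
      by (intro M.minus_equality) (simp_all add: complex_ring_def)
  qed
  have neg: "vnorm X (\<ominus> x) = vnorm X x" if "x \<in> carrier X" for x
    using that by (simp add: minus vnorm_smult)
  show "0 \<le> vdist X x y" for x y
    by (auto simp: vdist_def vnorm_nonneg)
  show "vdist X x y = vdist X y x" for x y
  proof (cases "x \<in> carrier X \<and> y \<in> carrier X")
    case True
    have "\<ominus> (x \<ominus> y) = y \<ominus> x"
      using True by (simp add: a_minus_def M.minus_add M.a_comm)
    then show ?thesis
      using True neg[of "x \<ominus> y"] by (simp add: vdist_def)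
  qed (auto simp: vdist_def)
  show "vdist X x y = 0 \<longleftrightarrow> x = y" if "x \<in> carrier X" "y \<in> carrier X" for x y
  proof -
    have "x \<ominus> y = \<zero> \<longleftrightarrow> x = y"
      using that by (metis M.a_inv_closed M.minus_equality M.minus_minus M.r_neg a_minus_def)
    then show ?thesis
      using that by (simp add: vdist_def vnorm_eq_zero)
  qed
  show "vdist X x z \<le> vdist X x y + vdist X y z"
    if "x \<in> carrier X" "y \<in> carrier X" "z \<in> carrier X" for x y z
  proof -
    have "x \<ominus> z = (x \<ominus> y) \<oplus> (y \<ominus> z)"
      using that by (simp add: a_minus_def M.a_assoc M.r_neg1)
    then show ?thesis
      using that vnorm_triangle[of "x \<ominus> y" "y \<ominus> z"] by (simp add: vdist_def)
  qed
qed

locale complex_banach_space = complex_normed_space +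
  assumes complete: "Metric_space.mcomplete (carrier X) (vdist X)"

text \<open>The existence of a separable Banach space is expressed below by a carrier inside
  \<^typ>\<open>nat \<Rightarrow> complex\<close>, with arbitrary operations and norm. This is no restriction: the carrier
  of every separable metric space, over any type, injects into \<^typ>\<open>nat \<Rightarrow> complex\<close>, and the
  structure can be transported along the injection.\<close>

lemma (in Metric_space) separable_inj_nat_complex:
  assumes "separable_space mtopology"
  shows "\<exists>f :: 'a \<Rightarrow> nat \<Rightarrow> complex. inj_on f M"
proof (cases "M = {}")
  case False
  obtain U where U: "countable U" "U \<subseteq> M" "mtopology closure_of U = M"
    using assms by (auto simp: separable_space_def)
  have "U \<noteq> {}"
    using U(3) False by auto
  have "inj_on (\<lambda>x n. complex_of_real (d x (from_nat_into U n))) M"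
  proof (rule inj_onI, rule ccontr)
    fix x y
    assume xy: "x \<in> M" "y \<in> M" "x \<noteq> y"
      and eq: "(\<lambda>n. complex_of_real (d x (from_nat_into U n))) =
               (\<lambda>n. complex_of_real (d y (from_nat_into U n)))"
    have pos: "0 < d x y / 2"
      using xy by simp
    have "x \<in> mtopology closure_of U"
      using U(3) xy by simp
    then obtain u where u: "u \<in> U" "u \<in> mball x (d x y / 2)"
      using pos unfolding metric_closure_of by blast
    obtain n where "from_nat_into U n = u"
      using from_nat_into_surj[OF U(1) u(1)] by blast
    then have "d x u = d y u"
      using fun_cong[OF eq, of n] by simp
    then show False
      using u(2) xy triangle[of x u y] commute[of u y] by auto
  qed
  then show ?thesis by blast
qed auto

section \<open>Operators and semigroups\<close>

text \<open>Taking the supremum in \<^typ>\<open>ennreal\<close> makes the value \<open>\<infinity>\<close> exactly for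
  unbounded operators.\<close>

definition op_norm :: "('v, 'm) normed_module_scheme \<Rightarrow> ('v \<Rightarrow> 'v) \<Rightarrow> ennreal" where
  "op_norm X f = (SUP x\<in>{x \<in> carrier X. vnorm X x \<le> 1}. ennreal (vnorm X (f x)))"

definition bounded_operator :: "('v, 'm) normed_module_scheme \<Rightarrow> ('v \<Rightarrow> 'v) \<Rightarrow> bool" where
  "bounded_operator X f \<longleftrightarrow>
     f \<in> carrier X \<rightarrow> carrier X \<and>
     (\<forall>x\<in>carrier X. \<forall>y\<in>carrier X. f (x \<oplus>\<^bsub>X\<^esub> y) = f x \<oplus>\<^bsub>X\<^esub> f y) \<and>
     (\<forall>c. \<forall>x\<in>carrier X. f (c \<odot>\<^bsub>X\<^esub> x) = c \<odot>\<^bsub>X\<^esub> f x) \<and>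
     op_norm X f < \<infinity>"

locale C0_semigroup = complex_banach_space +
  fixes T :: "real \<Rightarrow> 'a \<Rightarrow> 'a"
  assumes bounded_operator: "0 \<le> t \<Longrightarrow> bounded_operator X (T t)"
    and at_zero: "x \<in> carrier X \<Longrightarrow> T 0 x = x"
    and semigroup: "\<lbrakk>0 \<le> s; 0 \<le> t; x \<in> carrier X\<rbrakk> \<Longrightarrow> T (s + t) x = T s (T t x)"
    and strongly_continuous:
      "x \<in> carrier X \<Longrightarrow> limitin (norm_topology X) (\<lambda>t. T t x) x (at_right 0)"

text \<open>The infinitesimal generator is a partially defined operator, represented by its graph:
  \<open>x\<close> belongs to its domain iff the limit \<open>y\<close> of the difference quotients exists.\<close>

definition generator ::
  "('v, 'm) normed_module_scheme \<Rightarrow> (real \<Rightarrow> 'v \<Rightarrow> 'v) \<Rightarrow> ('v \<times> 'v) set" where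
  "generator X T = {(x, y). x \<in> carrier X \<and>
     limitin (norm_topology X)
       (\<lambda>h. complex_of_real (1 / h) \<odot>\<^bsub>X\<^esub> (T h x \<ominus>\<^bsub>X\<^esub> x)) y (at_right 0)}"

definition point_spectrum ::
  "('v, 'm) normed_module_scheme \<Rightarrow> ('v \<times> 'v) set \<Rightarrow> complex set" where
  "point_spectrum X A =
     {l. \<exists>x\<in>carrier X. x \<noteq> \<zero>\<^bsub>X\<^esub> \<and> (x, l \<odot>\<^bsub>X\<^esub> x) \<in> A}"

section \<open>Hausdorff dimension\<close>

text \<open>The summand \<open>(diam U)\<^sup>s\<close>, with the convention that for \<open>s = 0\<close> every nonempty set
  counts 1 (note that \<open>0 powr 0 = 0\<close> in HOL).\<close>

definition diam_powr :: "real \<Rightarrow> 'a::metric_space set \<Rightarrow> ennreal" where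
  "diam_powr s U =
     (if U = {} then 0 else if s = 0 then 1 else ennreal (diameter U powr s))"

text \<open>Boundedness of the covering sets is required explicitly, because \<^const>\<open>diameter\<close>
  is meaningless on unbounded sets.\<close>

definition hausdorff_premeasure :: "real \<Rightarrow> real \<Rightarrow> 'a::metric_space set \<Rightarrow> ennreal" where
  "hausdorff_premeasure \<delta> s E =
     (INF U\<in>{U :: nat \<Rightarrow> 'a set. E \<subseteq> (\<Union>i. U i) \<and> (\<forall>i. bounded (U i) \<and> diameter (U i) \<le> \<delta>)}.
        \<Sum>i. diam_powr s (U i))"

definition hausdorff_measure :: "real \<Rightarrow> 'a::metric_space set \<Rightarrow> ennreal" where
  "hausdorff_measure s E = (SUP \<delta>\<in>{0<..}. hausdorff_premeasure \<delta> s E)"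

definition hausdorff_dim :: "'a::metric_space set \<Rightarrow> ennreal" where
  "hausdorff_dim E = Inf {ennreal s |s. 0 \<le> s \<and> hausdorff_measure s E = 0}"

end

theory Submission
  imports Defs
begin

text \<open>Translations \<open>f \<mapsto> f(\<cdot> + y)\<close> have every character \<open>x \<mapsto> cis (\<theta> x)\<close> as an eigenvector, with
  eigenvalue \<open>\<i>\<theta>\<close> for the generator. So it suffices to find a weighted supremum norm for which
  translation by \<open>t k\<close> has norm at most 2, and a set of frequencies \<open>\<theta>\<close> of dimension 1 whose
  characters span a separable space.

  The weight is dictated by a metric on frequencies. Let
  \<open>\<delta>(\<theta>) = \<bar>\<theta>\<bar> + sup\<^sub>k \<bar>cis (\<theta> t k) - 1\<bar>\<close>, and let \<open>N(x)\<close> be the Lipschitz constant of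
  \<open>\<theta> \<mapsto> cis (\<theta> x)\<close> for the translation-invariant metric \<open>\<delta>(\<theta> - \<theta>')\<close>. Then \<open>N\<close> is subadditive,
  \<open>N(x) \<le> \<bar>x\<bar>\<close>, and \<open>N(t k) \<le> 1\<close> simply because \<open>t k\<close> occurs in the definition of \<open>\<delta>\<close>. In the norm
  \<open>sup\<^sub>x \<bar>f(x)\<bar> / (1 + N(x))\<close> subadditivity bounds translation by \<open>y\<close> by \<open>1 + N(y)\<close>: this is at most 2
  at the times \<open>t k\<close>, and locally bounded in \<open>y\<close>, which gives strong continuity on the closed span
  of the characters. Moreover the character of frequency \<open>\<theta>\<close> depends on \<open>\<theta>\<close> in a 1-Lipschitz way
  for \<open>\<delta>\<close>.

  The frequencies are the rigid ones, those with \<open>cis (\<theta> t k) \<longlonglongrightarrow> 1\<close>. They form a \<open>\<delta>\<close>-separable set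
  for the same reason that the space of null sequences is separable
  (\<open>rigid_frequencies_separable\<close>). They are numerous because the ratios \<open>t (k + 1) / t k\<close> tend to
  infinity: a Cantor set can keep \<open>\<theta> t k\<close> within a distance \<open>\<epsilon> k \<longlonglongrightarrow> 0\<close> of the multiples of \<open>2\<pi>\<close>
  while retaining a proportion of about \<open>\<epsilon> k\<close> of the \<open>t (k + 1) / t k\<close> possible choices at each
  level. Numbering its points by digits gives, for each \<open>s < 1\<close>, a map from \<open>[0,1)\<close> into it whose
  inverse is \<open>s\<close>-Hoelder (\<open>rigid_frequencies_hoelder_parametrization\<close>), so its \<open>s\<close>-dimensional
  measure does not vanish.

  In the formalization, functions are divided by the weight, so that the space becomes a subspace
  of the bounded continuous functions and translation becomes a weighted translation. Sampling at
  the rationals is injective on continuous functions and carries everything over to sequences.\<close>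

section \<open>Hausdorff dimension of subsets of the imaginary axis\<close>

text \<open>Covering both half-axes by consecutive segments of lengths \<open>c, c/2, c/3, \<dots>\<close> works because the
  harmonic series diverges while \<open>\<Sum> n\<^sup>-\<^sup>s\<close> converges for \<open>s > 1\<close>; the cost of the cover is
  proportional to \<open>c\<^sup>s\<close>.\<close>

lemma hausdorff_dim_le_1:
  fixes E :: "complex set"
  assumes "E \<subseteq> {z. Re z = 0}"
  shows "hausdorff_dim E \<le> 1"
proof -
  have null: "hausdorff_measure s E = 0" if s: "1 < s" for s
  proof -
    have "hausdorff_premeasure \<delta> s E = 0" if \<delta>: "0 < \<delta>" for \<delta>
    proof -
      define Z where "Z = (\<Sum>n. real (Suc n) powr (- s))"
      have sumZ: "summable (\<lambda>n. real (Suc n) powr (- s))"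
        using summable_real_powr_iff[of "-s"] s by (subst summable_Suc_iff) simp
      have bound: "hausdorff_premeasure \<delta> s E \<le> ennreal ((2 * c) powr s * Z)"
        if c: "0 < c" "2 * c \<le> \<delta>" for c
      proof -
        define a where "a j = c * (\<Sum>i<j. 1 / real (Suc i))" for j
        define \<sigma> where "\<sigma> n = (if even n then 1 else -1 :: real)" for n :: nat
        \<comment> \<open>Even indices run up the upper half-axis, odd indices down the lower one.\<close>
        define U where "U n = (\<lambda>y. Complex 0 (\<sigma> n * y)) ` {a (n div 2)..a (Suc (n div 2))}" for n
        have a_top: "\<exists>j. y < a j" for y
        proof (rule ccontr)
          assume "\<nexists>j. y < a j"
          then have le: "(\<Sum>i<j. 1 / real (Suc i)) \<le> y / c" for j
            using c by (simp add: a_def not_less field_simps)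
          have "summable (\<lambda>i. 1 / real (Suc i))"
            using le[of "Suc _"] unfolding lessThan_Suc_atMost
            by (intro bounded_imp_summable[where B = "y / c"]) auto
          then show False
            using not_summable_harmonic[where 'a = real] summable_Suc_iff[of "\<lambda>n. 1 / real n"]
            by (simp add: inverse_eq_divide)
        qed
        have cover: "E \<subseteq> (\<Union>i. U i)"
        proof
          fix z assume z: "z \<in> E"
          define j where "j = (LEAST j. \<bar>Im z\<bar> < a j)"
          have j: "\<bar>Im z\<bar> < a j" unfolding j_def by (rule LeastI_ex) (rule a_top)
          have "j \<noteq> 0"
          proof
            assume "j = 0"
            then show False using j by (simp add: a_def)
          qed
          then obtain i where i: "j = Suc i" using not0_implies_Suc by blast
          have "\<not> \<bar>Im z\<bar> < a i" using not_less_Least[of i "\<lambda>j. \<bar>Im z\<bar> < a j"] i by (simp add: j_def)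
          then have mem: "\<bar>Im z\<bar> \<in> {a i..a (Suc i)}" using j i by simp
          define n where "n = (if Im z \<ge> 0 then 2 * i else 2 * i + 1)"
          have "n div 2 = i" "\<sigma> n * \<bar>Im z\<bar> = Im z" by (auto simp: n_def \<sigma>_def)
          moreover have "z = Complex 0 (Im z)" using z assms by (auto simp: complex_eq_iff)
          ultimately have "z \<in> U n" unfolding U_def using mem by (intro image_eqI[of _ _ "\<bar>Im z\<bar>"]) auto
          then show "z \<in> (\<Union>i. U i)" by blast
        qed
        have dU: "dist x y \<le> 2 * c / real (Suc n)" if xy: "x \<in> U n" "y \<in> U n" for x y n
        proof -
          obtain u v where uv: "x = Complex 0 (\<sigma> n * u)" "y = Complex 0 (\<sigma> n * v)"
             "u \<in> {a (n div 2)..a (Suc (n div 2))}" "v \<in> {a (n div 2)..a (Suc (n div 2))}"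
            using xy unfolding U_def by blast
          have "dist x y = \<bar>\<sigma> n * u - \<sigma> n * v\<bar>"
            by (simp add: uv dist_complex_def cmod_def)
          also have "\<dots> = \<bar>u - v\<bar>" by (auto simp: \<sigma>_def)
          also have "\<dots> \<le> a (Suc (n div 2)) - a (n div 2)" using uv(3,4) by auto
          also have "\<dots> = c / real (Suc (n div 2))" by (simp add: a_def algebra_simps)
          also have "\<dots> \<le> 2 * c / real (Suc n)"
          proof -
            have "Suc n \<le> 2 * Suc (n div 2)" by presburger
            then have "real (Suc n) \<le> real (2 * Suc (n div 2))" by (simp only: of_nat_le_iff)
            then have "real (Suc n) \<le> 2 * real (Suc (n div 2))" by (simp only: of_nat_mult of_nat_numeral)
            then show ?thesis using c(1) by (simp add: field_simps del: of_nat_Suc)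
          qed
          finally show ?thesis .
        qed
        have ne: "U n \<noteq> {}" for n using c by (auto simp: U_def a_def)
        have bd: "bounded (U n)" for n
          using dU ne[of n] unfolding bounded_def by blast
        have diamU: "diameter (U n) \<le> 2 * c / real (Suc n)" for n
          using dU ne by (intro diameter_le) (auto simp: dist_norm)
        have diamU': "diameter (U n) \<le> \<delta>" for n
        proof -
          have "2 * c / real (Suc n) \<le> 2 * c" using c by (simp add: field_simps)
          then show ?thesis using diamU[of n] c by linarith
        qed
        have dp: "diam_powr s (U n) \<le> ennreal ((2 * c) powr s * real (Suc n) powr (- s))" for n
        proof -
          have "diameter (U n) powr s \<le> (2 * c / real (Suc n)) powr s"
            using diamU s diameter_ge_0[OF bd] by (intro powr_mono2) auto
          also have "\<dots> = (2 * c) powr s * real (Suc n) powr (- s)"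
            using c by (subst powr_divide) (auto simp: powr_minus divide_inverse)
          finally show ?thesis using s ne by (auto simp: diam_powr_def intro!: ennreal_leI)
        qed
        have "hausdorff_premeasure \<delta> s E \<le> (\<Sum>i. diam_powr s (U i))"
          unfolding hausdorff_premeasure_def
          using cover bd diamU' by (intro INF_lower) auto
        also have "\<dots> \<le> (\<Sum>n. ennreal ((2 * c) powr s * real (Suc n) powr (- s)))"
          using dp by (intro suminf_le) auto
        also have "\<dots> = ennreal (\<Sum>n. (2 * c) powr s * real (Suc n) powr (- s))"
          using sumZ by (intro suminf_ennreal2 summable_mult) auto
        also have "\<dots> = ennreal ((2 * c) powr s * Z)"
          unfolding Z_def using sumZ by (subst suminf_mult) auto
        finally show ?thesis .
      qed
      have "((\<lambda>c. ennreal ((2 * c) powr s * Z)) \<longlongrightarrow> ennreal 0) (at_right 0)"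
      proof (rule tendsto_ennrealI)
        have "((\<lambda>c. (2 * c) powr s * Z) \<longlongrightarrow> (2 * 0) powr s * Z) (at_right 0)"
          using s by (intro tendsto_intros tendsto_powr')
              (auto simp: eventually_at_right_less intro!: eventually_at_rightI[of 0 1])
        then show "((\<lambda>c. (2 * c) powr s * Z) \<longlongrightarrow> 0) (at_right 0)" by simp
      qed
      moreover have "\<forall>\<^sub>F c in at_right 0. hausdorff_premeasure \<delta> s E \<le> ennreal ((2 * c) powr s * Z)"
        using \<delta> by (intro eventually_at_rightI[of 0 "\<delta> / 2"] bound) auto
      ultimately have "hausdorff_premeasure \<delta> s E \<le> ennreal 0"
        by (rule tendsto_lowerbound) simp
      then show ?thesis by simp
    qed
    then have "hausdorff_measure s E \<le> 0"
      unfolding hausdorff_measure_def by (intro SUP_least) simp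
    then show ?thesis by simp
  qed
  show ?thesis
  proof (rule ennreal_le_epsilon)
    fix e :: real assume "0 < e"
    then have "hausdorff_dim E \<le> ennreal (1 + e)"
      unfolding hausdorff_dim_def using null[of "1 + e"]
      by (intro Inf_lower CollectI exI[of _ "1 + e"] conjI) auto
    then show "hausdorff_dim E \<le> 1 + ennreal e"
      using \<open>0 < e\<close> ennreal_plus[of 1 e] by simp
  qed
qed

text \<open>Mass distribution principle: the preimage in \<open>[0,1)\<close> of a covering set \<open>U\<close> lies in an interval of
  length \<open>2 C (diam U)\<^sup>s\<close>, and these intervals must have total length at least 1.\<close>

lemma hausdorff_measure_nonzero:
  fixes \<phi> :: "real \<Rightarrow> 'a::metric_space"
  assumes "0 \<le> s" and C: "1 \<le> C"
    and inE: "\<And>x. x \<in> {0..<1} \<Longrightarrow> \<phi> x \<in> E"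
    and hoelder: "\<And>x y. x \<in> {0..<1} \<Longrightarrow> y \<in> {0..<1} \<Longrightarrow> \<bar>x - y\<bar> \<le> C * dist (\<phi> x) (\<phi> y) powr s"
  shows "hausdorff_measure s E \<noteq> 0"
proof -
  have "ennreal (1 / (2 * C)) \<le> hausdorff_premeasure 1 s E"
    unfolding hausdorff_premeasure_def
  proof (rule INF_greatest, clarify)
    fix U :: "nat \<Rightarrow> 'a set"
    assume cover: "E \<subseteq> \<Union> (range U)" and U: "\<forall>i. bounded (U i) \<and> diameter (U i) \<le> 1"
    have "\<exists>V. V \<in> sets lborel \<and> {x \<in> {0..<1}. \<phi> x \<in> U i} \<subseteq> V \<and>
        emeasure lborel V \<le> ennreal (2 * C) * diam_powr s (U i)" for i
    proof (cases "\<exists>x0\<in>{0..<1}. \<phi> x0 \<in> U i")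
      case True
      then obtain x0 where x0: "x0 \<in> {0..<1}" "\<phi> x0 \<in> U i" by blast
      define D where "D = (if s = 0 then 1 else diameter (U i) powr s)"
      have D: "diam_powr s (U i) = ennreal D" "0 \<le> D"
        using x0 by (auto simp: diam_powr_def D_def)
      have "\<bar>x - x0\<bar> \<le> C * D" if x: "x \<in> {0..<1}" "\<phi> x \<in> U i" for x
      proof -
        have "dist (\<phi> x) (\<phi> x0) powr s \<le> D"
        proof (cases "s = 0")
          case False
          have "dist (\<phi> x) (\<phi> x0) \<le> diameter (U i)"
            using U x x0 by (intro diameter_bounded_bound) auto
          then show ?thesis using False \<open>0 \<le> s\<close> by (simp add: D_def powr_mono2)
        qed (simp add: D_def powr_def)
        then have "C * dist (\<phi> x) (\<phi> x0) powr s \<le> C * D" using C by (intro mult_left_mono) auto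
        then show ?thesis using hoelder[OF x(1) x0(1)] by linarith
      qed
      then have "{x \<in> {0..<1}. \<phi> x \<in> U i} \<subseteq> {x0 - C * D..x0 + C * D}"
        by (auto simp: abs_le_iff)
          (smt (verit, ccfv_SIG) atLeastLessThan_iff)+
      moreover have "emeasure lborel {x0 - C * D..x0 + C * D} = ennreal (2 * C) * diam_powr s (U i)"
        using C D by (simp flip: ennreal_mult add: algebra_simps)
      ultimately show ?thesis by (intro exI[of _ "{x0 - C * D..x0 + C * D}"]) auto
    next
      case False
      then show ?thesis by (intro exI[of _ "{}"]) auto
    qed
    then obtain V where V: "\<And>i. V i \<in> sets lborel" "\<And>i. {x \<in> {0..<1}. \<phi> x \<in> U i} \<subseteq> V i"
        "\<And>i. emeasure lborel (V i) \<le> ennreal (2 * C) * diam_powr s (U i)"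
      by metis
    have "{0..<1} \<subseteq> (\<Union>i. V i)"
    proof
      fix x :: real assume x: "x \<in> {0..<1}"
      then obtain i where "\<phi> x \<in> U i" using inE cover by blast
      then show "x \<in> (\<Union>i. V i)" using V(2)[of i] x by blast
    qed
    then have "emeasure lborel {0..<1::real} \<le> emeasure lborel (\<Union>i. V i)"
      using V(1) by (intro emeasure_mono) auto
    also have "\<dots> \<le> (\<Sum>i. emeasure lborel (V i))"
      using V(1) by (intro emeasure_subadditive_countably) auto
    also have "\<dots> \<le> (\<Sum>i. ennreal (2 * C) * diam_powr s (U i))"
      using V(3) by (intro suminf_le) auto
    also have "\<dots> = ennreal (2 * C) * (\<Sum>i. diam_powr s (U i))"
      by (rule ennreal_suminf_cmult)
    finally have "ennreal (1 / (2 * C)) * 1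
        \<le> ennreal (1 / (2 * C)) * (ennreal (2 * C) * (\<Sum>i. diam_powr s (U i)))"
      by (intro mult_left_mono) auto
    also have "\<dots> = (ennreal (1 / (2 * C)) * ennreal (2 * C)) * (\<Sum>i. diam_powr s (U i))"
      by (simp only: mult.assoc)
    also have "ennreal (1 / (2 * C)) * ennreal (2 * C) = 1"
      using C by (simp flip: ennreal_mult)
    finally show "ennreal (1 / (2 * C)) \<le> (\<Sum>i. diam_powr s (U i))" by simp
  qed
  moreover have "hausdorff_premeasure 1 s E \<le> hausdorff_measure s E"
    unfolding hausdorff_measure_def by (intro SUP_upper) auto
  moreover have "0 < ennreal (1 / (2 * C))"
    using C by simp
  ultimately show ?thesis by auto
qed

section \<open>Frequencies that are rigid along a sequence\<close>

definition rigid_frequencies :: "(nat \<Rightarrow> real) \<Rightarrow> real set" where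
  "rigid_frequencies t = {\<theta>. (\<lambda>k. cis (\<theta> * t k)) \<longlonglongrightarrow> 1}"

text \<open>A level-\<open>k\<close> interval of the Cantor set consists of the \<open>\<psi>\<close> with \<open>m \<le> \<psi> * u k \<le> m + 2 / a k\<close> for an
  integer \<open>m\<close>; it contains \<open>M k\<close> intervals of level \<open>k + 1\<close>, belonging to consecutive integers. The
  point with parameter \<open>x\<close> is found by following the digits of \<open>x\<close> in the mixed radix
  \<open>M 0, M 1, \<dots>\<close>, and \<open>P k = M 0 \<cdots> M (k - 1)\<close> counts the intervals of level \<open>k\<close>. The frequency is
  \<open>2\<pi>\<psi>\<close>. Two points whose digits first differ at place \<open>k\<close>, by \<open>q\<close>, have parameters at distance
  at most \<open>2q / P (k + 1)\<close> and frequencies at distance at least \<open>q / u (k + 1)\<close>. The Hoelder bound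
  therefore reduces to the comparison of \<open>P k\<close> with \<open>u k powr s\<close>.\<close>

lemma rigid_frequencies_hoelder_parametrization:
  fixes t :: "nat \<Rightarrow> real"
  assumes t_pos: "\<And>k. 0 < t k" and t_ratio: "filterlim (\<lambda>k. t (Suc k) / t k) at_top sequentially"
    and s: "0 < s" "s < 1"
  obtains \<phi> C where "1 \<le> C"
    and "\<And>x. x \<in> {0..<1} \<Longrightarrow> \<phi> x \<in> rigid_frequencies t"
    and "\<And>x y. x \<in> {0..<1} \<Longrightarrow> y \<in> {0..<1} \<Longrightarrow> \<bar>x - y\<bar> \<le> C * \<bar>\<phi> x - \<phi> y\<bar> powr s"
proof -
  have "\<forall>\<^sub>F R in at_top. 4 \<le> (R::real) powr (1 - s)" "\<forall>\<^sub>F R in at_top. 2 \<le> (R::real) powr s"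
    using filterlim_at_top[THEN iffD1, rule_format, OF real_powr_at_top, of "1 - s" 4]
      filterlim_at_top[THEN iffD1, rule_format, OF real_powr_at_top, of s 2] s by auto
  then have "\<forall>\<^sub>F R in at_top. 4 \<le> (R::real) powr (1 - s) \<and> 2 \<le> R powr s \<and> 0 < R"
    using eventually_gt_at_top[of 0] by eventually_elim auto
  then have "\<forall>\<^sub>F k in sequentially. 4 \<le> (t (Suc k) / t k) powr (1 - s) \<and>
      2 \<le> (t (Suc k) / t k) powr s \<and> 0 < t (Suc k) / t k"
    using t_ratio by (rule eventually_compose_filterlim)
  then obtain k0 where k0: "\<And>k. k \<ge> k0 \<Longrightarrow> 4 \<le> (t (Suc k) / t k) powr (1 - s) \<and> 2 \<le> (t (Suc k) / t k) powr s"
    by (auto simp: eventually_sequentially)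
  \<comment> \<open>The first terms are dropped, so that all ratios are large.\<close>
  define u where "u k = t (k0 + k)" for k
  define r where "r k = u (Suc k) / u k" for k
  \<comment> \<open>The tolerance \<open>2 / a k\<close> must tend to 0, but slowly compared with the growth of \<open>u\<close>.
    The bounds by \<open>r k\<close> and by \<open>r (k - 1)\<close> serve the two places where a ratio has to absorb
    the loss: the number of children \<open>M k\<close>, and the induction for \<open>P\<close>.\<close>
  define a where "a k = min (r (k - 1)) (r k) powr (1 - s)" for k
  \<comment> \<open>One less than the length allows, which leaves room for the tolerance of the last child.\<close>
  define M where "M k = \<lfloor>2 * r k / a k\<rfloor> - 1" for k
  define P where "P k = (\<Prod>i<k. M i)" for k
  have u_pos: "0 < u k" for k using t_pos by (simp add: u_def)
  have r_pos: "0 < r k" for k using u_pos by (simp add: r_def)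
  have r4: "4 \<le> r k powr (1 - s)" and r2: "2 \<le> r k powr s" for k
    using k0[of "k0 + k"] by (auto simp: r_def u_def)
  have u_Suc: "u (Suc k) = r k * u k" for k using u_pos[of k] by (simp add: r_def)
  have a_cases: "a k = r (k - 1) powr (1 - s) \<or> a k = r k powr (1 - s)" for k
    by (auto simp: a_def min_def)
  have a_ge: "4 \<le> a k" for k using a_cases[of k] r4 by metis
  then have a_pos: "0 < a k" for k by (meson less_le_trans zero_less_numeral)
  have a_le: "a k \<le> r k powr (1 - s)" and a_le_prev: "a (Suc k) \<le> r k powr (1 - s)" for k
    using s less_imp_le[OF r_pos] by (auto simp: a_def intro!: powr_mono2)
  have powr_split: "r k powr s * r k powr (1 - s) = r k" for k
    using r_pos[of k] by (simp flip: powr_add)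
  have ra2: "2 \<le> r k / a k" for k
  proof -
    have "2 * a k \<le> r k powr s * r k powr (1 - s)"
      using r2 a_le a_pos[of k] by (intro mult_mono) (auto intro: order_trans[OF _ r2])
    then show ?thesis using powr_split a_pos by (simp add: field_simps)
  qed
  have M_ge: "r k / a k \<le> real_of_int (M k)" for k
    unfolding M_def using ra2[of k] by linarith
  have M_le: "real_of_int (M k) \<le> 2 * r k / a k - 1" for k
    unfolding M_def by linarith
  have M2: "2 \<le> M k" for k using M_ge[of k] ra2[of k] by linarith
  have P_Suc: "P (Suc k) = P k * M k" for k by (simp add: P_def)
  have P_ge: "2 ^ k \<le> P k" for k
  proof (induction k)
    case (Suc k)
    have "2 ^ k * 2 \<le> P k * M k" using Suc M2[of k] by (intro mult_mono) (auto intro: order_trans[OF _ Suc])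
    then show ?case by (simp add: P_Suc mult.commute)
  qed (simp add: P_def)
  have P_pos: "0 < P k" for k using P_ge[of k] by (rule less_le_trans[rotated]) simp
  define A where "A = a 0 * u 0 powr s"
  have A_pos: "0 < A" using a_pos[of 0] u_pos[of 0] by (auto simp: A_def intro!: mult_pos_pos)
  \<comment> \<open>From \<open>k\<close> to \<open>k + 1\<close> the left side grows by the factor \<open>r k powr s * a (Suc k) / a k\<close>,
    which is at most \<open>r k / a k\<close> and hence at most \<open>M k\<close>.\<close>
  have growth: "u k powr s * a k \<le> A * P k" for k
  proof (induction k)
    case (Suc k)
    have "u (Suc k) powr s * a (Suc k) \<le> (r k powr s * u k powr s) * r k powr (1 - s)"
      unfolding u_Suc using u_pos[of k] r_pos[of k] a_le_prev[of k] by (simp add: powr_mult)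
    also have "\<dots> = (u k powr s * a k) * (r k / a k)"
      using powr_split[of k] a_pos[of k] by (simp add: mult_ac)
    also have "\<dots> \<le> (A * P k) * M k"
      by (rule mult_mono[OF Suc M_ge]) (use r_pos[of k] a_pos[of k] A_pos P_pos[of k] in auto)
    finally show ?case by (simp add: P_Suc mult_ac)
  qed (simp add: A_def P_def)
  \<comment> \<open>The children of an interval are numbered from the first integer not left of it.\<close>
  define dig where "dig x k = \<lfloor>x * P (Suc k)\<rfloor> - M k * \<lfloor>x * P k\<rfloor>" for x :: real and k
  define m where "m x = rec_nat (0::int) (\<lambda>k n. \<lceil>n * r k\<rceil> + dig x k)" for x
  have m_0: "m x 0 = 0" and m_Suc: "m x (Suc k) = \<lceil>m x k * r k\<rceil> + dig x k" for x k
    by (simp_all add: m_def)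
  have dig: "0 \<le> dig x k" "dig x k \<le> M k - 1" for x k
  proof -
    have e: "x * P (Suc k) = M k * (x * P k)" by (simp add: P_Suc mult_ac)
    have M0: "0 \<le> real_of_int (M k)" using M2[of k] by simp
    have "real_of_int (M k) * \<lfloor>x * P k\<rfloor> \<le> M k * (x * P k)"
      using M0 by (intro mult_left_mono) auto
    then have "M k * \<lfloor>x * P k\<rfloor> \<le> \<lfloor>M k * (x * P k)\<rfloor>" by (simp add: le_floor_iff)
    then show "0 \<le> dig x k" by (simp only: dig_def e)
    have "x * P k < real_of_int (\<lfloor>x * P k\<rfloor> + 1)" by linarith
    then have "real_of_int (M k) * (x * P k) < real_of_int (M k) * real_of_int (\<lfloor>x * P k\<rfloor> + 1)"
      using M2[of k] by (intro mult_strict_left_mono) auto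
    then have "\<lfloor>M k * (x * P k)\<rfloor> < M k * (\<lfloor>x * P k\<rfloor> + 1)" by (simp add: floor_less_iff)
    then show "dig x k \<le> M k - 1" unfolding dig_def e by (simp add: algebra_simps)
  qed
  define lo where "lo x k = m x k / u k" for x k
  define hi where "hi x k = (m x k + 2 / a k) / u k" for x k
  have lo_Suc: "lo x k \<le> lo x (Suc k)" for x k
  proof -
    have "m x k * r k \<le> m x (Suc k)"
      using dig(1)[of x k] le_of_int_ceiling[of "m x k * r k"] unfolding m_Suc by linarith
    then have "m x k * r k / u (Suc k) \<le> m x (Suc k) / u (Suc k)"
      using u_pos by (intro divide_right_mono) (auto intro: less_imp_le)
    then show ?thesis using r_pos[of k] by (simp add: lo_def u_Suc)
  qed
  have hi_Suc: "hi x (Suc k) \<le> hi x k" for x k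
  proof -
    have "2 / a (Suc k) \<le> 2 / 4" using a_ge[of "Suc k"] by (intro divide_left_mono) auto
    moreover have "real_of_int \<lceil>m x k * r k\<rceil> \<le> m x k * r k + 1" by linarith
    moreover have "real_of_int (dig x k) \<le> M k - 1" using dig(2)[of x k] by linarith
    ultimately have "m x (Suc k) + 2 / a (Suc k) \<le> (m x k + 2 / a k) * r k"
      unfolding m_Suc using M_le[of k] by (simp add: algebra_simps)
    then have "(m x (Suc k) + 2 / a (Suc k)) / u (Suc k) \<le> (m x k + 2 / a k) * r k / u (Suc k)"
      using u_pos by (intro divide_right_mono) (auto intro: less_imp_le)
    then show ?thesis using r_pos[of k] by (simp add: hi_def u_Suc)
  qed
  have inc: "incseq (lo x)" and dec: "decseq (hi x)" for x
    using lo_Suc hi_Suc by (auto intro: incseq_SucI decseq_SucI)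
  have lo_hi: "lo x k \<le> hi x k" for x k
    using u_pos[of k] a_pos[of k] by (simp add: lo_def hi_def divide_right_mono)
  have lo_hi': "lo x j \<le> hi x k" for x j k
    using incseqD[OF inc[of x], of j "max j k"] lo_hi[of x "max j k"] decseqD[OF dec[of x], of k "max j k"] by simp
  define \<psi> where "\<psi> x = (SUP k. lo x k)" for x
  have lo_psi: "lo x k \<le> \<psi> x" for x k
    unfolding \<psi>_def using lo_hi'[of x _ 0] by (intro cSUP_upper bdd_aboveI2) auto
  have psi_hi: "\<psi> x \<le> hi x k" for x k
    unfolding \<psi>_def using lo_hi' by (intro cSUP_least) auto
  have a_top: "filterlim a at_top sequentially"
  proof -
    have r_top: "filterlim r at_top sequentially"
      using filterlim_compose[OF t_ratio filterlim_add_const_nat_at_top[of k0]]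
      by (simp add: r_def[abs_def] u_def add.commute)
    have "filterlim (\<lambda>k. r k powr (1 - s)) at_top sequentially"
      using s by (intro filterlim_compose[OF real_powr_at_top r_top]) auto
    moreover have "filterlim (\<lambda>k. r (k - 1) powr (1 - s)) at_top sequentially"
      using filterlim_sequentially_Suc[of "\<lambda>k. r (k - 1) powr (1 - s)" at_top] calculation by simp
    ultimately show ?thesis unfolding filterlim_at_top
    proof (intro allI)
      fix Z
      assume 1: "\<forall>Z. \<forall>\<^sub>F k in sequentially. Z \<le> r k powr (1 - s)"
        and 2: "\<forall>Z. \<forall>\<^sub>F k in sequentially. Z \<le> r (k - 1) powr (1 - s)"
      show "\<forall>\<^sub>F k in sequentially. Z \<le> a k"
        using 1[rule_format, of Z] 2[rule_format, of Z]
        by eventually_elim (use a_cases in metis)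
    qed
  qed
  define \<phi> where "\<phi> x = 2 * pi * \<psi> x" for x
  show thesis
  proof (rule that)
    show "\<phi> x \<in> rigid_frequencies t" for x
    proof -
      have frac: "0 \<le> \<psi> x * u k - m x k" "\<psi> x * u k - m x k \<le> 2 / a k" for k
        using lo_psi[of x k] psi_hi[of x k] u_pos[of k] by (auto simp: lo_def hi_def field_simps)
      have "(\<lambda>k. 2 / a k) \<longlonglongrightarrow> 0"
        by (rule tendsto_divide_0[OF tendsto_const filterlim_at_top_imp_at_infinity[OF a_top]])
      then have "(\<lambda>k. \<psi> x * u k - m x k) \<longlonglongrightarrow> 0"
        by (rule tendsto_sandwich[OF always_eventually[OF allI[OF frac(1)]]
              always_eventually[OF allI[OF frac(2)]] tendsto_const])
      then have "(\<lambda>k. cis (2 * pi * (\<psi> x * u k - m x k))) \<longlonglongrightarrow> cis (2 * pi * 0)"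
        by (intro tendsto_cis tendsto_intros)
      moreover have "cis (2 * pi * (\<psi> x * u k - m x k)) = cis (\<phi> x * u k)" for k
      proof -
        have "cis (2 * pi * m x k) = 1" by (rule cis_multiple_2pi) auto
        then show ?thesis by (simp add: \<phi>_def right_diff_distrib flip: cis_divide) (simp add: mult_ac)
      qed
      ultimately have "(\<lambda>k. cis (\<phi> x * t (k + k0))) \<longlonglongrightarrow> 1"
        by (simp add: u_def add.commute)
      then have "(\<lambda>k. cis (\<phi> x * t k)) \<longlonglongrightarrow> 1"
        by (rule LIMSEQ_offset)
      then show ?thesis by (simp add: rigid_frequencies_def)
    qed
    define C where "C = max 1 (2 * A)"
    show "1 \<le> C" by (simp add: C_def)
    have main: "y - x \<le> C * (\<phi> y - \<phi> x) powr s \<and> \<phi> x \<le> \<phi> y"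
      if x: "x \<in> {0..<1}" and y: "y \<in> {0..<1}" and less: "x < y" for x y
    proof -
      have "\<exists>k. \<lfloor>x * P k\<rfloor> \<noteq> \<lfloor>y * P k\<rfloor>"
      proof -
        obtain k where "1 / (y - x) < 2 ^ k"
          using real_arch_pow[of 2 "1 / (y - x)"] by auto
        also have "(2::real) ^ k \<le> P k" using P_ge[of k] by (metis of_int_le_iff of_int_numeral of_int_power)
        finally have "1 < (y - x) * P k" using less by (simp add: field_simps)
        then have "x * P k + 1 < y * P k" by (simp add: algebra_simps)
        then have "\<lfloor>x * P k\<rfloor> \<noteq> \<lfloor>y * P k\<rfloor>" by linarith
        then show ?thesis ..
      qed
      define j where "j = (LEAST k. \<lfloor>x * P k\<rfloor> \<noteq> \<lfloor>y * P k\<rfloor>)"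
      have j: "\<lfloor>x * P j\<rfloor> \<noteq> \<lfloor>y * P j\<rfloor>"
        unfolding j_def by (rule LeastI_ex) fact
      have before: "\<lfloor>x * P k\<rfloor> = \<lfloor>y * P k\<rfloor>" if "k < j" for k
        using not_less_Least that unfolding j_def by blast
      have "j \<noteq> 0"
      proof
        assume "j = 0"
        moreover have "\<lfloor>x\<rfloor> = 0" "\<lfloor>y\<rfloor> = 0" using x y by (auto simp: floor_eq_iff)
        ultimately show False using j by (simp add: P_def)
      qed
      then obtain k where k: "j = Suc k" using not0_implies_Suc by blast
      have m_eq: "m x i = m y i" if "i < j" for i
        using that
      proof (induction i)
        case (Suc i)
        then show ?case using before[of i] before[of "Suc i"] by (simp add: m_Suc dig_def)
      qed (simp add: m_0)
      define q where "q = dig y k - dig x k"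
      have q_floor: "q = \<lfloor>y * P (Suc k)\<rfloor> - \<lfloor>x * P (Suc k)\<rfloor>"
        using before[of k] k by (simp add: q_def dig_def)
      have m_q: "m y (Suc k) - m x (Suc k) = q"
        using m_eq[of k] k by (simp add: m_Suc q_def)
      have "\<lfloor>x * P (Suc k)\<rfloor> \<le> \<lfloor>y * P (Suc k)\<rfloor>"
        using less P_pos[of "Suc k"] by (intro floor_mono mult_right_mono) auto
      then have q1: "1 \<le> q" using j k q_floor by simp
      have qM: "q \<le> M k" using dig[of y k] dig[of x k] by (simp add: q_def)
      have diff: "q / u (Suc k) \<le> \<phi> y - \<phi> x"
      proof -
        have "2 / a (Suc k) \<le> 2 / 4" using a_ge[of "Suc k"] by (intro divide_left_mono) auto
        then have "q / 2 \<le> q - 2 / a (Suc k)" using q1 by simp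
        then have "q / 2 / u (Suc k) \<le> (q - 2 / a (Suc k)) / u (Suc k)"
          using u_pos by (intro divide_right_mono) (auto intro: less_imp_le)
        also have "\<dots> = lo y (Suc k) - hi x (Suc k)"
          unfolding lo_def hi_def by (simp flip: m_q add: diff_divide_distrib add_divide_distrib)
        also have "\<dots> \<le> \<psi> y - \<psi> x" using lo_psi[of y "Suc k"] psi_hi[of x "Suc k"] by linarith
        finally have 1: "q / u (Suc k) \<le> 2 * (\<psi> y - \<psi> x)" by simp
        moreover have "0 \<le> q / u (Suc k)" using q1 u_pos[of "Suc k"] by simp
        ultimately have "0 \<le> 2 * (\<psi> y - \<psi> x)" by (rule order_trans[rotated])
        then have "0 \<le> \<psi> y - \<psi> x" by simp
        then have "2 * (\<psi> y - \<psi> x) \<le> 2 * pi * (\<psi> y - \<psi> x)"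
          using pi_ge_two by (intro mult_right_mono) auto
        with 1 show ?thesis by (simp add: \<phi>_def algebra_simps)
      qed
      have q_pos: "0 < real_of_int q" using q1 by simp
      have Mp: "0 < real_of_int (M k)" using M2[of k] by simp
      \<comment> \<open>The worst case is \<open>q = M k\<close>, where \<open>growth\<close> at level \<open>k\<close> yields the bound.\<close>
      have key: "u (Suc k) powr s * q powr (1 - s) \<le> A * P (Suc k)"
      proof -
        have ak: "1 \<le> a k powr (1 - s)" using a_ge[of k] s by (intro ge_one_powr_ge_zero) auto
        have "u (Suc k) powr s \<le> r k powr s * u k powr s * a k powr (1 - s)"
          unfolding u_Suc using ak u_pos[of k] r_pos[of k] by (simp add: powr_mult)
        also have "\<dots> = (u k powr s * a k) * (r k / a k) powr s"
        proof -
          have "a k powr (1 - s) = a k / a k powr s" using a_pos[of k] by (simp add: powr_diff)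
          then show ?thesis using a_pos[of k] r_pos[of k] by (simp add: powr_divide)
        qed
        also have "\<dots> \<le> (A * P k) * M k powr s"
          by (rule mult_mono[OF growth powr_mono2[OF _ _ M_ge]])
            (use r_pos[of k] a_pos[of k] A_pos P_pos[of k] s in auto)
        finally have "u (Suc k) powr s * q powr (1 - s) \<le> ((A * P k) * M k powr s) * M k powr (1 - s)"
          using q_pos qM s A_pos P_pos[of k] by (intro mult_mono powr_mono2) (auto intro: less_imp_le)
        also have "\<dots> = A * P k * (M k powr s * M k powr (1 - s))" by simp
        also have "M k powr s * M k powr (1 - s) = M k" using Mp by (simp flip: powr_add)
        finally show ?thesis by (simp add: P_Suc mult_ac)
      qed
      have "y * P (Suc k) - x * P (Suc k) \<le> q + 1" unfolding q_floor by linarith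
      also have "\<dots> \<le> 2 * real_of_int q" using q1 by simp
      finally have "(y - x) * P (Suc k) \<le> 2 * real_of_int q" by (simp add: algebra_simps)
      also have "2 * real_of_int q = 2 * (q powr s * q powr (1 - s))"
        using q_pos by (simp flip: powr_add)
      also have "2 * (q powr s * q powr (1 - s)) \<le> 2 * (q powr s * (A * P (Suc k) / u (Suc k) powr s))"
        using key u_pos[of "Suc k"] by (intro mult_left_mono) (auto simp: field_simps)
      also have "\<dots> = (2 * A * (q / u (Suc k)) powr s) * P (Suc k)"
        using q_pos u_pos[of "Suc k"] by (simp add: powr_divide)
      finally have "y - x \<le> 2 * A * (q / u (Suc k)) powr s"
        by (rule mult_right_le_imp_le) (use P_pos[of "Suc k"] in simp)
      also have "\<dots> \<le> C * (\<phi> y - \<phi> x) powr s"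
        using diff q_pos u_pos[of "Suc k"] s A_pos
        by (intro mult_mono powr_mono2) (auto simp: C_def intro: less_imp_le)
      finally have "y - x \<le> C * (\<phi> y - \<phi> x) powr s" .
      moreover have "0 < q / u (Suc k)" using q_pos u_pos[of "Suc k"] by simp
      then have "0 < \<phi> y - \<phi> x" using diff by (rule less_le_trans)
      ultimately show ?thesis by simp
    qed
    show "\<bar>x - y\<bar> \<le> C * \<bar>\<phi> x - \<phi> y\<bar> powr s" if "x \<in> {0..<1}" "y \<in> {0..<1}" for x y
      using main[OF that] main[OF that(2,1)] by (cases x y rule: linorder_cases) (auto simp: abs_minus_commute)
  qed
qed

text \<open>For \<open>s = 0\<close> the Hoelder bound only asks that the map be injective, which follows from the bound
  for a positive exponent.\<close>

lemma hausdorff_measure_rigid_frequencies: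
  fixes t :: "nat \<Rightarrow> real"
  assumes "\<And>k. 0 < t k" and "filterlim (\<lambda>k. t (Suc k) / t k) at_top sequentially"
    and s: "0 \<le> s" "s < 1" and E: "(\<lambda>\<theta>. \<i> * of_real \<theta>) ` rigid_frequencies t \<subseteq> E"
  shows "hausdorff_measure s E \<noteq> 0"
proof -
  define s' where "s' = (if s = 0 then 1 / 2 else s)"
  have s': "0 < s'" "s' < 1" using s by (auto simp: s'_def)
  obtain \<phi> C where C: "1 \<le> C" and \<phi>: "\<And>x. x \<in> {0..<1} \<Longrightarrow> \<phi> x \<in> rigid_frequencies t"
    and hoelder: "\<And>x y. x \<in> {0..<1} \<Longrightarrow> y \<in> {0..<1} \<Longrightarrow> \<bar>x - y\<bar> \<le> C * \<bar>\<phi> x - \<phi> y\<bar> powr s'"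
    using rigid_frequencies_hoelder_parametrization[OF assms(1,2) s'] by metis
  show ?thesis
  proof (rule hausdorff_measure_nonzero[OF s(1) C, of "\<lambda>x. \<i> * of_real (\<phi> x)"])
    show "\<i> * of_real (\<phi> x) \<in> E" if "x \<in> {0..<1}" for x
      using \<phi>[OF that] E by blast
    fix x y :: real assume xy: "x \<in> {0..<1}" "y \<in> {0..<1}"
    have dist: "dist (\<i> * complex_of_real (\<phi> x)) (\<i> * of_real (\<phi> y)) = \<bar>\<phi> x - \<phi> y\<bar>"
      by (simp add: dist_norm norm_mult flip: right_diff_distrib of_real_diff)
    show "\<bar>x - y\<bar> \<le> C * dist (\<i> * complex_of_real (\<phi> x)) (\<i> * of_real (\<phi> y)) powr s"
    proof (cases "s = 0 \<and> \<phi> x \<noteq> \<phi> y")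
      case True
      then show ?thesis using xy C unfolding dist by auto
    next
      case False
      then show ?thesis using hoelder[OF xy] unfolding dist s'_def by (auto split: if_splits)
    qed
  qed
qed

section \<open>A weight measuring how fast characters oscillate\<close>

lemma cmod_cis_minus_1_le: "cmod (cis a - 1) \<le> \<bar>a\<bar>"
proof -
  have "cmod (cis a - 1) = 2 * \<bar>sin (a / 2)\<bar>"
    using dist_exp_i_1[of a] by (simp add: cis_conv_exp)
  also have "\<dots> \<le> \<bar>a\<bar>" using abs_sin_x_le_abs_x[of "a / 2"] by simp
  finally show ?thesis .
qed

lemma cmod_cis_diff: "cmod (cis a - cis b) = cmod (cis (a - b) - 1)"
proof -
  have "cis a - cis b = cis b * (cis (a - b) - 1)"
    by (simp add: right_diff_distrib cis_mult)
  then show ?thesis by (simp add: norm_mult)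
qed

lemma cmod_cis_add_minus_1: "cmod (cis (a + b) - 1) \<le> cmod (cis a - 1) + cmod (cis b - 1)"
proof -
  have "cis (a + b) - 1 = cis a * (cis b - 1) + (cis a - 1)"
    by (simp add: right_diff_distrib cis_mult)
  then have "cmod (cis (a + b) - 1) \<le> cmod (cis a * (cis b - 1)) + cmod (cis a - 1)"
    using norm_triangle_ineq[of "cis a * (cis b - 1)" "cis a - 1"] by (simp only:)
  then show ?thesis by (simp add: norm_mult)
qed

text \<open>The distance of a frequency from 0. The term \<open>\<bar>\<theta>\<bar>\<close> controls translations by arbitrary times, the
  supremum controls translations by the times \<open>t k\<close>.\<close>

definition rotation_size :: "(nat \<Rightarrow> real) \<Rightarrow> real \<Rightarrow> real" where
  "rotation_size t \<theta> = \<bar>\<theta>\<bar> + (SUP k. cmod (cis (\<theta> * t k) - 1))"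

lemma cmod_cis_minus_1_le_2: "cmod (cis a - 1) \<le> 2"
  using norm_triangle_ineq4[of "cis a" 1] by simp

lemma rotation_size_ge:
  shows "\<bar>\<theta>\<bar> \<le> rotation_size t \<theta>" and "cmod (cis (\<theta> * t k) - 1) \<le> rotation_size t \<theta>"
proof -
  have bdd: "bdd_above (range (\<lambda>k. cmod (cis (\<theta> * t k) - 1)))"
    using cmod_cis_minus_1_le_2 by (intro bdd_aboveI2)
  have "cmod (cis (\<theta> * t k) - 1) \<le> (SUP k. cmod (cis (\<theta> * t k) - 1))" for k
    using bdd by (intro cSUP_upper) auto
  moreover from this[of 0] have "0 \<le> (SUP k. cmod (cis (\<theta> * t k) - 1))"
    by (rule order_trans[OF norm_ge_zero])
  ultimately show "\<bar>\<theta>\<bar> \<le> rotation_size t \<theta>" "cmod (cis (\<theta> * t k) - 1) \<le> rotation_size t \<theta>"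
    unfolding rotation_size_def by (simp_all add: add_increasing)
qed

text \<open>The Lipschitz constant of \<open>\<theta> \<mapsto> cis (\<theta> * x)\<close> for the metric \<open>rotation_size t (\<theta> - \<theta>')\<close>; by
  translation invariance only the increments from 0 have to be considered. The frequency
  \<open>\<theta> = 0\<close> contributes \<open>0 / 0 = 0\<close>.\<close>

definition oscillation :: "(nat \<Rightarrow> real) \<Rightarrow> real \<Rightarrow> real" where
  "oscillation t x = (SUP \<theta>. cmod (cis (\<theta> * x) - 1) / rotation_size t \<theta>)"

lemma rotation_size_eq_0: "rotation_size t \<theta> \<le> 0 \<Longrightarrow> \<theta> = 0"
  using rotation_size_ge(1)[of \<theta> t] by simp

lemma rotation_size_nonneg: "0 \<le> rotation_size t \<theta>"
  using rotation_size_ge(1)[of \<theta> t] by simp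

lemma oscillation_le:
  assumes "0 \<le> b" and "\<And>\<theta>. cmod (cis (\<theta> * x) - 1) \<le> b * rotation_size t \<theta>"
  shows "oscillation t x \<le> b"
  unfolding oscillation_def
proof (rule cSUP_least)
  fix \<theta>
  show "cmod (cis (\<theta> * x) - 1) / rotation_size t \<theta> \<le> b"
  proof (cases "rotation_size t \<theta> = 0")
    case False
    then have "0 < rotation_size t \<theta>" using rotation_size_nonneg[of t \<theta>] by simp
    then show ?thesis using assms(2)[of \<theta>] by (simp add: pos_divide_le_eq)
  qed (use assms(1) in simp)
qed simp

lemma cmod_cis_le_abs_rotation_size: "cmod (cis (\<theta> * x) - 1) \<le> \<bar>x\<bar> * rotation_size t \<theta>"
proof -
  have "cmod (cis (\<theta> * x) - 1) \<le> \<bar>x\<bar> * \<bar>\<theta>\<bar>"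
    using cmod_cis_minus_1_le[of "\<theta> * x"] by (simp add: abs_mult mult.commute)
  also have "\<dots> \<le> \<bar>x\<bar> * rotation_size t \<theta>"
    using rotation_size_ge(1) by (intro mult_left_mono) auto
  finally show ?thesis .
qed

lemma cmod_cis_le_oscillation: "cmod (cis (\<theta> * x) - 1) \<le> oscillation t x * rotation_size t \<theta>"
proof (cases "rotation_size t \<theta> = 0")
  case True
  then show ?thesis using rotation_size_eq_0[of t \<theta>] by simp
next
  case False
  then have pos: "0 < rotation_size t \<theta>" using rotation_size_nonneg[of t \<theta>] by simp
  have "cmod (cis (\<theta>' * x) - 1) / rotation_size t \<theta>' \<le> \<bar>x\<bar>" for \<theta>'
    using cmod_cis_le_abs_rotation_size[of \<theta>' x t] rotation_size_nonneg[of t \<theta>']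
    by (cases "rotation_size t \<theta>' = 0") (simp_all add: divide_le_eq)
  then have "cmod (cis (\<theta> * x) - 1) / rotation_size t \<theta> \<le> oscillation t x"
    unfolding oscillation_def by (intro cSUP_upper bdd_aboveI2) auto
  then show ?thesis using pos by (simp add: pos_divide_le_eq)
qed

lemma oscillation_le_abs: "oscillation t x \<le> \<bar>x\<bar>"
  by (intro oscillation_le cmod_cis_le_abs_rotation_size) simp

lemma oscillation_at_times: "oscillation t (t k) \<le> 1"
  using rotation_size_ge(2) by (intro oscillation_le) auto

lemma oscillation_nonneg: "0 \<le> oscillation t x"
proof -
  have pos: "0 < rotation_size t 1" using rotation_size_ge(1)[of 1 t] by simp
  have "0 \<le> oscillation t x * rotation_size t 1"
    by (rule order_trans[OF norm_ge_zero cmod_cis_le_oscillation])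
  then show ?thesis using pos by (simp add: zero_le_mult_iff)
qed

lemma oscillation_add: "oscillation t (x + y) \<le> oscillation t x + oscillation t y"
proof (rule oscillation_le)
  fix \<theta>
  have "cmod (cis (\<theta> * (x + y)) - 1) \<le> cmod (cis (\<theta> * x) - 1) + cmod (cis (\<theta> * y) - 1)"
    using cmod_cis_add_minus_1[of "\<theta> * x" "\<theta> * y"] by (simp add: distrib_left)
  also have "\<dots> \<le> (oscillation t x + oscillation t y) * rotation_size t \<theta>"
    unfolding distrib_right by (intro add_mono cmod_cis_le_oscillation)
  finally show "cmod (cis (\<theta> * (x + y)) - 1) \<le> (oscillation t x + oscillation t y) * rotation_size t \<theta>" .
qed (simp add: oscillation_nonneg)

lemma continuous_oscillation: "continuous_on UNIV (oscillation t)"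
proof -
  have "oscillation t x - oscillation t y \<le> \<bar>x - y\<bar>" for x y
    using oscillation_add[of t y "x - y"] oscillation_le_abs[of t "x - y"] by simp
  then have "dist (oscillation t x) (oscillation t y) \<le> 1 * dist x y" for x y
    unfolding dist_real_def by (smt (verit))
  then have "1-lipschitz_on UNIV (oscillation t)"
    by (intro lipschitz_onI) auto
  then show ?thesis by (rule lipschitz_on_continuous_on)
qed

text \<open>For a rigid frequency all rotations \<open>cis (\<theta> * t k)\<close> beyond some index \<open>n\<close> are close to 1, and the
  finitely many earlier ones change little when \<open>\<theta>\<close> changes by at most \<open>w n\<close>. Sorting the frequencies
  by \<open>n\<close> and by the cell of the grid of mesh \<open>w n\<close> that contains them gives countably many classes of
  diameter at most \<open>e\<close>; one representative of each is taken.\<close>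

lemma rigid_frequencies_separable:
  assumes "0 < e"
  shows "\<exists>C. countable C \<and> C \<subseteq> rigid_frequencies t \<and>
    (\<forall>\<theta>\<in>rigid_frequencies t. \<exists>c\<in>C. rotation_size t (\<theta> - c) \<le> e)"
proof -
  define W where "W n = 1 + (\<Sum>i<n. \<bar>t i\<bar>)" for n
  define w where "w n = e / (2 * W n)" for n
  define K where "K = (\<lambda>(n, j :: int). {\<theta> \<in> rigid_frequencies t.
      (\<forall>k\<ge>n. cmod (cis (\<theta> * t k) - 1) \<le> e / 4) \<and> \<lfloor>\<theta> / w n\<rfloor> = j})"
  define C where "C = (\<lambda>p. SOME \<theta>. \<theta> \<in> K p) ` {p. K p \<noteq> {}}"
  have some: "(SOME \<theta>. \<theta> \<in> K p) \<in> K p" if "K p \<noteq> {}" for p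
    using that by (simp add: some_in_eq)
  have small: "rotation_size t (\<theta> - c) \<le> e" if K: "\<theta> \<in> K (n, j)" "c \<in> K (n, j)" for \<theta> c n j
  proof -
    have W_ge: "1 \<le> W n" by (simp add: W_def sum_nonneg)
    then have w_pos: "0 < w n" using assms by (simp add: w_def)
    have eq: "w n * W n = e / 2" using W_ge by (simp add: w_def)
    have "\<lfloor>\<theta> / w n\<rfloor> = \<lfloor>c / w n\<rfloor>" using K by (simp add: K_def)
    then have "\<bar>\<theta> / w n - c / w n\<bar> \<le> 1" by linarith
    then have close: "\<bar>\<theta> - c\<bar> \<le> w n"
      using w_pos by (simp flip: diff_divide_distrib add: abs_divide)
    have "cmod (cis ((\<theta> - c) * t k) - 1) \<le> e / 2" for k
    proof (cases "k < n")
      case True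
      have "cmod (cis ((\<theta> - c) * t k) - 1) \<le> \<bar>\<theta> - c\<bar> * \<bar>t k\<bar>"
        using cmod_cis_minus_1_le[of "(\<theta> - c) * t k"] by (simp add: abs_mult)
      also have "\<dots> \<le> w n * W n"
      proof (rule mult_mono[OF close])
        have "\<bar>t k\<bar> \<le> (\<Sum>i<n. \<bar>t i\<bar>)" using True by (intro member_le_sum) auto
        then show "\<bar>t k\<bar> \<le> W n" by (simp add: W_def)
      qed (use w_pos in auto)
      finally show ?thesis by (simp only: eq)
    next
      case False
      then have "cmod (cis (\<theta> * t k) - 1) \<le> e / 4" "cmod (cis (c * t k) - 1) \<le> e / 4"
        using K by (auto simp: K_def)
      moreover have "cmod (cis ((\<theta> - c) * t k) - 1) = cmod ((cis (\<theta> * t k) - 1) - (cis (c * t k) - 1))"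
        using cmod_cis_diff[of "\<theta> * t k" "c * t k"] by (simp add: left_diff_distrib)
      ultimately show ?thesis
        using norm_triangle_ineq4[of "cis (\<theta> * t k) - 1" "cis (c * t k) - 1"] by linarith
    qed
    then have "(SUP k. cmod (cis ((\<theta> - c) * t k) - 1)) \<le> e / 2" by (intro cSUP_least) auto
    moreover have "w n \<le> w n * W n" using w_pos W_ge by simp
    ultimately show ?thesis using close eq unfolding rotation_size_def by linarith
  qed
  show ?thesis
  proof (intro exI[of _ C] conjI ballI)
    show "countable C" unfolding C_def by (intro countable_image countableI_type)
    have "K p \<subseteq> rigid_frequencies t" for p by (auto simp: K_def)
    then show "C \<subseteq> rigid_frequencies t" unfolding C_def using some by blast
    fix \<theta> assume \<theta>: "\<theta> \<in> rigid_frequencies t"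
    then have "(\<lambda>k. cis (\<theta> * t k)) \<longlonglongrightarrow> 1" by (simp add: rigid_frequencies_def)
    then have "\<forall>\<^sub>F k in sequentially. dist (cis (\<theta> * t k)) 1 < e / 4"
      using assms by (intro tendstoD) auto
    then obtain n where "\<forall>k\<ge>n. cmod (cis (\<theta> * t k) - 1) \<le> e / 4"
      by (auto simp: eventually_sequentially dist_norm intro: less_imp_le)
    then have mem: "\<theta> \<in> K (n, \<lfloor>\<theta> / w n\<rfloor>)" using \<theta> by (simp add: K_def)
    then have ne: "K (n, \<lfloor>\<theta> / w n\<rfloor>) \<noteq> {}" by blast
    show "\<exists>c\<in>C. rotation_size t (\<theta> - c) \<le> e"
      using small[OF mem some[OF ne]] ne unfolding C_def by (intro bexI[OF _ imageI]) auto
  qed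
qed

section \<open>Translations on a weighted space of continuous functions\<close>

definition cscale :: "complex \<Rightarrow> (real \<Rightarrow>\<^sub>C complex) \<Rightarrow> (real \<Rightarrow>\<^sub>C complex)" where
  "cscale c f = Bcontfun (\<lambda>x. c * f x)"

lemma apply_cscale [simp]: "cscale c f x = c * f x"
proof -
  have "(\<lambda>x. c * f x) \<in> bcontfun"
    by (rule bcontfun_normI[of _ "cmod c * norm f"])
      (auto intro!: continuous_intros mult_left_mono norm_bounded simp: norm_mult)
  then show ?thesis by (simp add: cscale_def Bcontfun_inverse)
qed

lemma norm_cscale: "norm (cscale c f) = cmod c * norm f"
proof (rule antisym)
  show le: "norm (cscale c f) \<le> cmod c * norm f" for c f
    by (rule norm_bound) (auto intro!: mult_left_mono norm_bounded simp: norm_mult)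
  show "cmod c * norm f \<le> norm (cscale c f)"
  proof (cases "c = 0")
    case False
    have "f = cscale (1 / c) (cscale c f)" using False by (intro bcontfun_eqI) simp
    then have "norm f \<le> cmod (1 / c) * norm (cscale c f)" using le by metis
    then show ?thesis using False by (simp add: norm_divide field_simps)
  qed simp
qed

text \<open>Write \<open>N\<close> for \<open>oscillation t\<close>. A function \<open>F\<close> of the weighted space is represented by
  the bounded function \<open>F / (1 + N)\<close>; here
  \<open>F\<close> is a character.\<close>

definition weighted_character :: "(nat \<Rightarrow> real) \<Rightarrow> real \<Rightarrow> (real \<Rightarrow>\<^sub>C complex)" where
  "weighted_character t \<theta> = Bcontfun (\<lambda>x. cis (\<theta> * x) / of_real (1 + oscillation t x))"

lemma weight_pos: "0 < 1 + oscillation t x"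
  using oscillation_nonneg[of t x] by simp

lemma apply_weighted_character [simp]:
  "weighted_character t \<theta> x = cis (\<theta> * x) / of_real (1 + oscillation t x)"
proof -
  have "(\<lambda>x. cis (\<theta> * x) / of_real (1 + oscillation t x)) \<in> bcontfun"
  proof (rule bcontfun_normI[of _ 1])
    show "continuous_on UNIV (\<lambda>x. cis (\<theta> * x) / of_real (1 + oscillation t x))"
      using weight_pos[of t]
      by (intro continuous_intros continuous_oscillation) (metis less_irrefl of_real_eq_0_iff)
    show "cmod (cis (\<theta> * x) / of_real (1 + oscillation t x)) \<le> 1" for x
      using weight_pos[of t x] oscillation_nonneg[of t x] by (simp add: norm_divide del: of_real_add)
  qed
  then show ?thesis by (simp add: weighted_character_def Bcontfun_inverse)
qed

text \<open>Translation \<open>F \<mapsto> F(\<cdot> + y)\<close> in terms of \<open>f = F / (1 + N)\<close>.\<close>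

definition weighted_translation :: "(nat \<Rightarrow> real) \<Rightarrow> real \<Rightarrow> (real \<Rightarrow>\<^sub>C complex) \<Rightarrow> (real \<Rightarrow>\<^sub>C complex)" where
  "weighted_translation t y f =
     Bcontfun (\<lambda>x. of_real ((1 + oscillation t (x + y)) / (1 + oscillation t x)) * f (x + y))"

text \<open>By subadditivity, \<open>1 + N(x + y) \<le> 1 + N(x) + N(y) \<le> (1 + N(x)) (1 + N(y))\<close>.\<close>

lemma weight_ratio_le: "(1 + oscillation t (x + y)) / (1 + oscillation t x) \<le> 1 + oscillation t y"
proof -
  have "1 + oscillation t (x + y) \<le> (1 + oscillation t y) * (1 + oscillation t x)"
    using oscillation_add[of t x y] mult_nonneg_nonneg[OF oscillation_nonneg[of t x] oscillation_nonneg[of t y]]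
    by (simp add: algebra_simps)
  then show ?thesis using weight_pos[of t x] by (simp add: pos_divide_le_eq)
qed

lemma cmod_weighted_translation_le:
  "cmod (of_real ((1 + oscillation t (x + y)) / (1 + oscillation t x)) * f (x + y)) \<le> (1 + oscillation t y) * norm f"
  for f :: "real \<Rightarrow>\<^sub>C complex"
proof -
  have "\<bar>(1 + oscillation t (x + y)) / (1 + oscillation t x)\<bar> \<le> 1 + oscillation t y"
    using weight_ratio_le[of t x y] weight_pos[of t x] weight_pos[of t "x + y"] by simp
  then show ?thesis unfolding norm_mult norm_of_real
    using weight_pos[of t y] by (intro mult_mono norm_bounded) auto
qed

lemma apply_weighted_translation [simp]:
  "weighted_translation t y f x = of_real ((1 + oscillation t (x + y)) / (1 + oscillation t x)) * f (x + y)"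
proof -
  have "continuous_on UNIV (\<lambda>x. oscillation t (x + y))"
    by (rule continuous_on_compose2[OF continuous_oscillation]) (auto intro!: continuous_intros)
  moreover have "continuous_on UNIV (\<lambda>x. f (x + y))"
    by (rule continuous_on_compose2[OF continuous_on_apply_bcontfun[of UNIV f]]) (auto intro!: continuous_intros)
  ultimately have "(\<lambda>x. of_real ((1 + oscillation t (x + y)) / (1 + oscillation t x)) * f (x + y)) \<in> bcontfun"
    using weight_pos[of t] cmod_weighted_translation_le
    by (intro bcontfun_normI continuous_intros continuous_oscillation) (auto simp: less_le)
  then show ?thesis by (simp add: weighted_translation_def Bcontfun_inverse)
qed

lemma norm_weighted_translation: "norm (weighted_translation t y f) \<le> (1 + oscillation t y) * norm f"
  by (rule norm_bound) (simp only: apply_weighted_translation cmod_weighted_translation_le)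

lemma weighted_translation_character:
  "weighted_translation t y (weighted_character t \<theta>) = cscale (cis (\<theta> * y)) (weighted_character t \<theta>)"
proof (rule bcontfun_eqI)
  fix x
  have "complex_of_real (1 + oscillation t (x + y)) \<noteq> 0"
    using weight_pos[of t "x + y"] by (metis less_irrefl of_real_eq_0_iff)
  then show "weighted_translation t y (weighted_character t \<theta>) x =
     cscale (cis (\<theta> * y)) (weighted_character t \<theta>) x"
    by (simp add: distrib_left cis_mult add.commute del: of_real_add)
qed

lemma dist_weighted_character:
  "dist (weighted_character t \<theta>) (weighted_character t \<theta>') \<le> rotation_size t (\<theta> - \<theta>')"
proof (rule dist_bound)
  fix x
  have "dist (weighted_character t \<theta> x) (weighted_character t \<theta>' x) =
      cmod (cis (\<theta> * x) - cis (\<theta>' * x)) / (1 + oscillation t x)"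
    using weight_pos[of t x] by (simp add: dist_norm norm_divide del: of_real_add flip: diff_divide_distrib)
  also have "\<dots> = cmod (cis ((\<theta> - \<theta>') * x) - 1) / (1 + oscillation t x)"
    by (simp add: cmod_cis_diff left_diff_distrib)
  also have "\<dots> \<le> rotation_size t (\<theta> - \<theta>')"
    using cmod_cis_le_oscillation[of "\<theta> - \<theta>'" x t] weight_pos[of t x] rotation_size_nonneg[of t "\<theta> - \<theta>'"]
    by (simp add: pos_divide_le_eq algebra_simps)
  finally show "dist (weighted_character t \<theta> x) (weighted_character t \<theta>' x) \<le> rotation_size t (\<theta> - \<theta>')" .
qed

lemma weighted_translation_0: "weighted_translation t 0 f = f"
proof (rule bcontfun_eqI)
  fix x
  have "1 + oscillation t x \<noteq> 0" using weight_pos[of t x] by simp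
  then show "weighted_translation t 0 f x = f x" by simp
qed

lemma weighted_translation_add:
  "weighted_translation t (s + y) f = weighted_translation t s (weighted_translation t y f)"
proof (rule bcontfun_eqI)
  fix x
  have "1 + oscillation t (x + s) \<noteq> 0" using weight_pos[of t "x + s"] by simp
  then have eq: "(1 + oscillation t (x + s)) / (1 + oscillation t x) *
      ((1 + oscillation t (x + (s + y))) / (1 + oscillation t (x + s)))
      = (1 + oscillation t (x + (s + y))) / (1 + oscillation t x)" by simp
  show "weighted_translation t (s + y) f x = weighted_translation t s (weighted_translation t y f) x"
    by (simp only: apply_weighted_translation add.assoc mult.assoc[symmetric] of_real_mult[symmetric] eq)
qed

lemma bounded_linear_weighted_translation: "bounded_linear (weighted_translation t y)"
proof (rule bounded_linear_intro[of _ "1 + oscillation t y"])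
  show "norm (weighted_translation t y f) \<le> norm f * (1 + oscillation t y)" for f
    using norm_weighted_translation[of t y f] by (simp only: mult.commute)
qed (auto intro!: bcontfun_eqI simp del: of_real_divide of_real_add simp: distrib_left scaleR_conv_of_real)

lemma weighted_translation_cscale: "weighted_translation t y (cscale c f) = cscale c (weighted_translation t y f)"
  by (rule bcontfun_eqI) simp


section \<open>Closed complex spans\<close>

text \<open>Rational scalars suffice, since every real is a limit of rationals. This applies both to
  subspaces and to the countable set of rational combinations of a set.\<close>

lemma subspace_closure:
  fixes D :: "'a::real_normed_vector set"
  assumes "0 \<in> D" and D_add: "\<And>x y. x \<in> D \<Longrightarrow> y \<in> D \<Longrightarrow> x + y \<in> D"
    and D_scale: "\<And>q x. q \<in> \<rat> \<Longrightarrow> x \<in> D \<Longrightarrow> q *\<^sub>R x \<in> D"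
  shows "subspace (closure D)"
proof (rule subspaceI)
  show "0 \<in> closure D" using \<open>0 \<in> D\<close> closure_subset by blast
next
  fix x y assume "x \<in> closure D" "y \<in> closure D"
  then obtain f g where f: "\<And>n. f n \<in> D" "f \<longlonglongrightarrow> x" and g: "\<And>n. g n \<in> D" "g \<longlonglongrightarrow> y"
    unfolding closure_sequential by blast
  show "x + y \<in> closure D" unfolding closure_sequential
    by (intro exI[of _ "\<lambda>n. f n + g n"] conjI allI tendsto_add D_add f g)
next
  fix c :: real and x assume "x \<in> closure D"
  then obtain f where f: "\<And>n. f n \<in> D" "f \<longlonglongrightarrow> x"
    unfolding closure_sequential by blast
  have "c \<in> closure \<rat>" by (simp add: Rats_closure_real)
  then obtain q :: "nat \<Rightarrow> real" where q: "\<And>n. q n \<in> \<rat>" "q \<longlonglongrightarrow> c"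
    unfolding closure_sequential by blast
  show "c *\<^sub>R x \<in> closure D" unfolding closure_sequential
    by (intro exI[of _ "\<lambda>n. q n *\<^sub>R f n"] conjI allI tendsto_scaleR D_scale f q)
qed

text \<open>The complex structure is a parameter, so that the topology, the completeness and the bounded
  operators can be those of the underlying real Banach space.\<close>

locale complex_scaling =
  fixes cs :: "complex \<Rightarrow> 'b::{real_normed_vector, complete_space} \<Rightarrow> 'b"
  assumes cs_add: "cs c (x + y) = cs c x + cs c y"
    and cs_left_add: "cs (c + d) x = cs c x + cs d x"
    and cs_cs: "cs c (cs d x) = cs (c * d) x"
    and cs_of_real: "cs (of_real r) x = r *\<^sub>R x"
    and norm_cs: "norm (cs c x) = cmod c * norm x"
begin

lemma bounded_linear_cs: "bounded_linear (cs c)"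
proof (rule bounded_linear_intro[of _ "cmod c"])
  show "cs c (r *\<^sub>R x) = r *\<^sub>R cs c x" for r x
    unfolding cs_of_real[symmetric] cs_cs by (simp only: mult.commute)
qed (simp_all add: cs_add norm_cs mult.commute)

lemma cs_one [simp]: "cs 1 x = x"
  using cs_of_real[of 1 x] by simp

lemma bounded_linear_cs_left: "bounded_linear (\<lambda>c. cs c x)"
proof (rule bounded_linear_intro[of _ "norm x"])
  show "cs (r *\<^sub>R c) x = r *\<^sub>R cs c x" for r c
    by (simp add: scaleR_conv_of_real flip: cs_of_real cs_cs)
qed (simp_all add: cs_left_add norm_cs)

lemma cs_diff_left: "cs (c - d) x = cs c x - cs d x"
  using cs_left_add[of "c - d" d x] by (simp add: algebra_simps)

text \<open>The complex span is a real span once the multiples by \<open>\<i>\<close> of the generators are added.\<close>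

definition closed_cspan :: "'b set \<Rightarrow> 'b set" where
  "closed_cspan G = closure (span (G \<union> cs \<i> ` G))"

lemma closed_closed_cspan: "closed (closed_cspan G)"
  by (simp add: closed_cspan_def)

lemma subspace_closed_cspan: "subspace (closed_cspan G)"
  unfolding closed_cspan_def by (intro subspace_closure span_zero span_add span_scale)

lemma closed_cspan_superset: "G \<subseteq> closed_cspan G"
  unfolding closed_cspan_def using order_trans[OF span_superset closure_subset, of "G \<union> cs \<i> ` G"] by simp

lemma closed_cspan_invariant:
  assumes F: "bounded_linear F" and comm: "\<And>c x. F (cs c x) = cs c (F x)"
    and S: "subspace S" "closed S" "\<And>c x. x \<in> S \<Longrightarrow> cs c x \<in> S"
    and G: "\<And>g. g \<in> G \<Longrightarrow> F g \<in> S" and x: "x \<in> closed_cspan G"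
  shows "F x \<in> S"
proof -
  interpret bounded_linear F by fact
  have "F y \<in> S" if "y \<in> span (G \<union> cs \<i> ` G)" for y
    using that
  proof (induction rule: span_induct_alt)
    case base
    then show ?case using subspace_0[OF S(1)] by (simp add: zero)
  next
    case (step c g y)
    then have "F g \<in> S" using G S(3) comm by auto
    then show ?case using step S(1) by (simp add: add scaleR subspace_add subspace_scale)
  qed
  then have "F ` closure (span (G \<union> cs \<i> ` G)) \<subseteq> S"
    by (intro image_closure_subset linear_continuous_on F S(2)) auto
  then show ?thesis using x unfolding closed_cspan_def by blast
qed

lemma cs_closed_cspan:
  assumes "x \<in> closed_cspan G"
  shows "cs c x \<in> closed_cspan G"
proof -
  have cs_span: "cs c y \<in> span (G \<union> cs \<i> ` G)" if "y \<in> span (G \<union> cs \<i> ` G)" for y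
  proof -
    have gen: "cs c g \<in> span (G \<union> cs \<i> ` G)" if "g \<in> G" for c g
    proof -
      have "c = of_real (Re c) + of_real (Im c) * \<i>" by (simp add: complex_eq_iff)
      then have "cs c g = Re c *\<^sub>R g + Im c *\<^sub>R cs \<i> g"
        by (metis cs_left_add cs_cs cs_of_real)
      moreover have "g \<in> span (G \<union> cs \<i> ` G)" "cs \<i> g \<in> span (G \<union> cs \<i> ` G)"
        using that by (auto intro: span_base)
      ultimately show ?thesis by (simp add: span_add span_scale)
    qed
    show ?thesis using that
    proof (induction rule: span_induct_alt)
      case base
      then show ?case using bounded_linear.linear[OF bounded_linear_cs] by (simp add: linear_0 span_zero)
    next
      case (step r g y)
      have "cs c g \<in> span (G \<union> cs \<i> ` G)" using step(1) gen by (auto simp: cs_cs)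
      then show ?case using step bounded_linear.linear[OF bounded_linear_cs]
        by (simp add: linear_add linear_scale span_add span_scale)
    qed
  qed
  have "cs c ` closure (span (G \<union> cs \<i> ` G)) \<subseteq> closure (span (G \<union> cs \<i> ` G))"
    using cs_span closure_subset
    by (intro image_closure_subset linear_continuous_on bounded_linear_cs) auto
  then show ?thesis using assms unfolding closed_cspan_def by blast
qed

text \<open>The vectors with \<open>F h x \<longlonglongrightarrow> x\<close> form a closed complex subspace, because the operators are uniformly
  bounded near the limit.\<close>

lemma closed_cspan_tendsto_id:
  assumes F: "\<And>h. bounded_linear (F h)" and comm: "\<And>h c x. F h (cs c x) = cs c (F h x)"
    and bound: "\<forall>\<^sub>F h in A. \<forall>x. norm (F h x) \<le> M * norm x"
    and G: "\<And>g. g \<in> G \<Longrightarrow> ((\<lambda>h. F h g) \<longlongrightarrow> g) A" and x: "x \<in> closed_cspan G"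
  shows "((\<lambda>h. F h x) \<longlongrightarrow> x) A"
proof -
  define S where "S = {x. ((\<lambda>h. F h x) \<longlongrightarrow> x) A}"
  have lin: "linear (F h)" for h using F by (rule bounded_linear.linear)
  have sub: "subspace S"
    by (rule subspaceI) (auto simp: S_def linear_0[OF lin] linear_add[OF lin] linear_scale[OF lin] intro: tendsto_intros)
  have "closed S"
    unfolding closed_sequential_limits
  proof (intro allI impI, elim conjE)
    fix f l assume f: "\<forall>n. f n \<in> S" "f \<longlonglongrightarrow> l"
    have "((\<lambda>h. F h l) \<longlongrightarrow> l) A"
    proof (rule tendstoI)
      fix e :: real assume e: "0 < e"
      define m where "m = \<bar>M\<bar> + 2"
      define d where "d = e / (2 * m)"
      have m: "0 < m" by (simp add: m_def add_nonneg_pos)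
      have d: "0 < d" using e m by (simp add: d_def)
      have dM: "m * d = e / 2" using m by (simp add: d_def)
      obtain n where n: "dist (f n) l < d"
        using tendstoD[OF f(2) d] by (auto simp: eventually_sequentially)
      have "\<forall>\<^sub>F h in A. dist (F h (f n)) (f n) < d"
        using f(1) d by (intro tendstoD) (auto simp: S_def)
      then show "\<forall>\<^sub>F h in A. dist (F h l) l < e"
        using bound
      proof eventually_elim
        case (elim h)
        have "dist (F h l) (F h (f n)) = norm (F h (l - f n))"
          by (simp add: dist_norm linear_diff[OF lin])
        also have "\<dots> \<le> M * norm (l - f n)" using elim by blast
        also have "\<dots> \<le> \<bar>M\<bar> * norm (l - f n)" by (intro mult_right_mono) auto
        also have "\<dots> \<le> \<bar>M\<bar> * d"
          using n by (intro mult_left_mono) (auto simp: dist_norm norm_minus_commute)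
        finally have "dist (F h l) l \<le> \<bar>M\<bar> * d + d + d"
          using elim n dist_triangle[of "F h l" l "F h (f n)"] dist_triangle[of "F h (f n)" l "f n"] by linarith
        also have "\<dots> = e / 2" using dM by (simp add: m_def algebra_simps)
        finally show ?case using e by simp
      qed
    qed
    then show "l \<in> S" by (simp add: S_def)
  qed
  moreover have "cs c y \<in> S" if "y \<in> S" for c y
    using that bounded_linear.tendsto[OF bounded_linear_cs] by (simp add: S_def comm)
  moreover have "g \<in> S" if "g \<in> G" for g using G[OF that] by (simp add: S_def)
  ultimately have "x \<in> S"
    using closed_cspan_invariant[OF bounded_linear_ident _ sub, of G x] x by simp
  then show ?thesis by (simp add: S_def)
qed

lemma separable_closed_cspan:
  assumes G: "\<And>e. 0 < e \<Longrightarrow> \<exists>C. countable C \<and> C \<subseteq> G \<and> (\<forall>g\<in>G. \<exists>c\<in>C. dist g c \<le> e)"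
  shows "\<exists>D. countable D \<and> D \<subseteq> closed_cspan G \<and> closed_cspan G \<subseteq> closure D"
proof -
  obtain C where C: "\<And>e. 0 < e \<Longrightarrow> countable (C e) \<and> C e \<subseteq> G \<and> (\<forall>g\<in>G. \<exists>c\<in>C e. dist g c \<le> e)"
    using G by metis
  define E where "E = (\<Union>n. C (1 / real (Suc n)))"
  have "countable (C (1 / real (Suc n)))" "C (1 / real (Suc n)) \<subseteq> G" for n
    using C[of "1 / real (Suc n)"] by simp_all
  then have E: "countable E" "E \<subseteq> G"
    unfolding E_def by blast+
  have G_closure: "G \<subseteq> closure E"
  proof
    fix g assume g: "g \<in> G"
    show "g \<in> closure E"
      unfolding closure_approachable
    proof (intro allI impI)
      fix e :: real assume "0 < e"
      then obtain n where n: "1 / real (Suc n) < e" by (rule nat_approx_posE)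
      obtain c where "c \<in> C (1 / real (Suc n))" "dist g c \<le> 1 / real (Suc n)"
        using C[of "1 / real (Suc n)"] g by auto
      then show "\<exists>y\<in>E. dist y g < e"
        using n by (intro bexI[of _ c]) (auto simp: E_def dist_commute)
    qed
  qed
  define B where "B = E \<union> cs \<i> ` E"
  have B_countable: "countable B" using E by (simp add: B_def)
  define D where "D = (\<lambda>l. \<Sum>(q, b)\<leftarrow>l. real_of_rat q *\<^sub>R b) ` lists (UNIV \<times> B)"
  have "countable D"
    unfolding D_def using B_countable by (intro countable_image countable_lists countable_SIGMA) auto
  have D_add: "x + y \<in> D" if "x \<in> D" "y \<in> D" for x y
  proof -
    obtain k l where kl: "k \<in> lists (UNIV \<times> B)" "l \<in> lists (UNIV \<times> B)"
      "x = (\<Sum>(q, b)\<leftarrow>k. real_of_rat q *\<^sub>R b)" "y = (\<Sum>(q, b)\<leftarrow>l. real_of_rat q *\<^sub>R b)"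
      using \<open>x \<in> D\<close> \<open>y \<in> D\<close> unfolding D_def by blast
    then show ?thesis unfolding D_def by (intro image_eqI[of _ _ "k @ l"]) auto
  qed
  have D_scale: "real_of_rat p *\<^sub>R x \<in> D" if "x \<in> D" for p x
  proof -
    obtain l where l: "l \<in> lists (UNIV \<times> B)" "x = (\<Sum>(q, b)\<leftarrow>l. real_of_rat q *\<^sub>R b)"
      using \<open>x \<in> D\<close> unfolding D_def by blast
    have "real_of_rat p *\<^sub>R (\<Sum>(q, b)\<leftarrow>l. real_of_rat q *\<^sub>R b) =
        (\<Sum>(q, b)\<leftarrow>map (\<lambda>(q, b). (p * q, b)) l. real_of_rat q *\<^sub>R b)"
      by (induction l) (auto simp: scaleR_add_right of_rat_mult)
    then show ?thesis
      using l unfolding D_def by (intro image_eqI[of _ _ "map (\<lambda>(q, b). (p * q, b)) l"]) auto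
  qed
  have "0 \<in> D" unfolding D_def by (intro image_eqI[of _ _ "[]"]) auto
  have B_D: "B \<subseteq> D"
  proof
    fix b assume "b \<in> B"
    then show "b \<in> D" unfolding D_def by (intro image_eqI[of _ _ "[(1, b)]"]) auto
  qed
  have sub: "subspace (closure D)"
    using \<open>0 \<in> D\<close> D_add D_scale by (intro subspace_closure) (auto elim!: Rats_cases)
  have "cs \<i> ` closure E \<subseteq> closure (cs \<i> ` E)"
    by (intro image_closure_subset linear_continuous_on bounded_linear_cs closure_subset closed_closure)
  moreover have "closure E \<subseteq> closure D" "closure (cs \<i> ` E) \<subseteq> closure D"
    using B_D by (auto simp: B_def intro!: closure_mono)
  ultimately have "G \<union> cs \<i> ` G \<subseteq> closure D"
    using G_closure by blast
  then have "span (G \<union> cs \<i> ` G) \<subseteq> closure D"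
    using sub by (intro span_minimal)
  then have "closed_cspan G \<subseteq> closure D"
    unfolding closed_cspan_def by (intro closure_minimal) auto
  moreover have "D \<subseteq> closed_cspan G"
  proof
    fix x assume "x \<in> D"
    then obtain l where l: "l \<in> lists (UNIV \<times> B)" "x = (\<Sum>(q, b)\<leftarrow>l. real_of_rat q *\<^sub>R b)"
      unfolding D_def by blast
    have "B \<subseteq> closed_cspan G"
      using E closed_cspan_superset[of G] cs_closed_cspan by (auto simp: B_def)
    with l(1) have "(\<Sum>(q, b)\<leftarrow>l. real_of_rat q *\<^sub>R b) \<in> closed_cspan G"
    proof (induction l)
      case (Cons p l)
      then show ?case using subspace_closed_cspan[of G]
        by (cases p) (auto intro!: subspace_add subspace_scale)
    qed (simp add: subspace_0 subspace_closed_cspan)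
    then show "x \<in> closed_cspan G" using l by simp
  qed
  ultimately show ?thesis using \<open>countable D\<close> by blast
qed

end

section \<open>Transport along an injection\<close>

text \<open>Copying a closed complex subspace along an injection puts its carrier into any type that is large
  enough, whatever the type in which the space is most easily constructed.\<close>

locale encoded_subspace = complex_scaling cs
  for cs :: "complex \<Rightarrow> 'b::{real_normed_vector, complete_space} \<Rightarrow> 'b" +
  fixes code :: "'b \<Rightarrow> 'c" and S :: "'b set"
  assumes inj_code: "inj code"
    and subspace_S: "subspace S" and closed_S: "closed S"
    and cs_S: "x \<in> S \<Longrightarrow> cs c x \<in> S"
begin

abbreviation decode :: "'c \<Rightarrow> 'b" where
  "decode \<equiv> inv_into UNIV code"

definition X :: "'c normed_module" where
  "X = \<lparr>carrier = code ` S, monoid.mult = (\<lambda>_ _. code 0), one = code 0, ring.zero = code 0,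
     add = (\<lambda>u v. code (decode u + decode v)),
     module.smult = (\<lambda>c u. code (cs c (decode u))),
     vnorm = (\<lambda>u. norm (decode u))\<rparr>"

lemma X_simps:
  "carrier X = code ` S" "\<zero>\<^bsub>X\<^esub> = code 0" "u \<oplus>\<^bsub>X\<^esub> v = code (decode u + decode v)"
  "c \<odot>\<^bsub>X\<^esub> u = code (cs c (decode u))" "vnorm X u = norm (decode u)"
  by (simp_all add: X_def)

lemma decode_code [simp]: "decode (code x) = x"
  using inj_code by simp

lemma S_closed: "0 \<in> S" "x \<in> S \<Longrightarrow> y \<in> S \<Longrightarrow> x + y \<in> S" "x \<in> S \<Longrightarrow> y \<in> S \<Longrightarrow> x - y \<in> S" "x \<in> S \<Longrightarrow> - x \<in> S"
  using subspace_S by (auto intro: subspace_0 subspace_add subspace_diff subspace_neg)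

lemma abelian_group_X: "abelian_group X"
proof (rule abelian_groupI)
  fix x assume "x \<in> carrier X"
  then obtain a where "a \<in> S" "x = code a" by (auto simp: X_simps)
  then show "\<exists>y\<in>carrier X. y \<oplus>\<^bsub>X\<^esub> x = \<zero>\<^bsub>X\<^esub>"
    by (intro bexI[of _ "code (- a)"]) (auto simp: X_simps S_closed)
qed (auto simp: X_simps S_closed add_ac)

lemma module_X: "Module.module complex_ring X"
  by (rule moduleI[OF cring_complex_ring abelian_group_X])
    (auto simp: X_simps complex_ring_def cs_S cs_left_add cs_add cs_cs)

lemma complex_normed_space_X: "complex_normed_space X"
  unfolding complex_normed_space_def complex_normed_space_axioms_def
  using module_X inj_code by (auto simp: X_simps norm_triangle_ineq norm_cs dest: injD)

lemma X_minus: "x \<in> S \<Longrightarrow> y \<in> S \<Longrightarrow> code x \<ominus>\<^bsub>X\<^esub> code y = code (x - y)"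
proof -
  assume xy: "x \<in> S" "y \<in> S"
  interpret abelian_group X by (rule abelian_group_X)
  have "\<ominus>\<^bsub>X\<^esub> code y = code (- y)"
    using xy by (intro minus_equality) (auto simp: X_simps S_closed)
  then show "code x \<ominus>\<^bsub>X\<^esub> code y = code (x - y)"
    by (simp add: a_minus_def X_simps)
qed

lemma vdist_X: "x \<in> S \<Longrightarrow> y \<in> S \<Longrightarrow> vdist X (code x) (code y) = dist x y"
  by (simp add: vdist_def X_minus dist_norm) (simp add: X_simps)

sublocale M: Metric_space "carrier X" "vdist X"
  by (rule complex_normed_space.Metric_space_vdist[OF complex_normed_space_X])

lemma limitin_X:
  assumes "\<forall>\<^sub>F h in F. f h \<in> S" "l \<in> S" "(f \<longlongrightarrow> l) F"
  shows "limitin (norm_topology X) (\<lambda>h. code (f h)) (code l) F"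
  unfolding M.limitin_metric
proof (intro conjI allI impI)
  show "code l \<in> carrier X" using assms by (simp add: X_simps)
  fix e :: real assume "0 < e"
  with assms(3) have "\<forall>\<^sub>F h in F. dist (f h) l < e" by (rule tendstoD)
  with assms(1) show "\<forall>\<^sub>F h in F. code (f h) \<in> carrier X \<and> vdist X (code (f h)) (code l) < e"
    by eventually_elim (use assms(2) in \<open>simp add: vdist_X\<close>, simp add: X_simps)
qed

lemma complex_banach_space_X: "complex_banach_space X"
proof -
  have "M.mcomplete"
    unfolding M.mcomplete_def
  proof (intro allI impI)
    fix \<sigma> assume \<sigma>: "M.MCauchy \<sigma>"
    define f where "f n = decode (\<sigma> n)" for n
    have f: "f n \<in> S" "\<sigma> n = code (f n)" for n
      using \<sigma> unfolding M.MCauchy_def by (auto simp: f_def X_simps image_subset_iff) (metis decode_code imageE)+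
    have "Cauchy f"
      using \<sigma> unfolding M.MCauchy_def Cauchy_def by (simp add: f vdist_X)
    then obtain l where l: "f \<longlonglongrightarrow> l" unfolding Cauchy_convergent_iff convergent_def by blast
    then have "l \<in> S" using closed_S f(1) by (auto simp: closed_sequential_limits)
    then have "limitin M.mtopology (\<lambda>n. code (f n)) (code l) sequentially"
      using l f(1) by (intro limitin_X) auto
    then show "\<exists>x. limitin M.mtopology \<sigma> x sequentially" by (auto simp flip: f(2))
  qed
  then show ?thesis
    using complex_normed_space_X by (simp add: complex_banach_space_def complex_banach_space_axioms_def)
qed

lemma separable_X:
  assumes "countable D" "D \<subseteq> S" "S \<subseteq> closure D"
  shows "separable_space (norm_topology X)"
  unfolding separable_space_def
proof (intro exI conjI)
  show "countable (code ` D)" using assms(1) by simp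
  have "code ` D \<subseteq> carrier X"
    unfolding X_simps(1) using assms(2) by (rule image_mono)
  then show "code ` D \<subseteq> topspace (norm_topology X)"
    by (simp only: M.topspace_mtopology)
  have "\<exists>v\<in>code ` D. v \<in> M.mball u r" if u: "u \<in> carrier X" and r: "0 < r" for u r
  proof -
    obtain x where x: "x \<in> S" "u = code x" using u by (auto simp: X_simps)
    then have "x \<in> closure D" using assms(3) by blast
    then obtain y where y: "y \<in> D" "dist y x < r"
      using r unfolding closure_approachable by blast
    then have "y \<in> S" using assms(2) by blast
    then have "code y \<in> M.mball u r"
      using x y unfolding M.in_mball by (simp add: vdist_X dist_commute) (simp add: X_simps)
    then show ?thesis using y by blast
  qed
  then have "norm_topology X closure_of code ` D = carrier X"
    unfolding M.metric_closure_of by blast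
  then show "norm_topology X closure_of code ` D = topspace (norm_topology X)"
    by (simp only: M.topspace_mtopology)
qed

definition encode_op :: "('b \<Rightarrow> 'b) \<Rightarrow> 'c \<Rightarrow> 'c" where
  "encode_op F u = code (F (decode u))"

lemma op_norm_encode_op:
  assumes "\<And>x. x \<in> S \<Longrightarrow> norm (F x) \<le> M * norm x" "0 \<le> M"
  shows "op_norm X (encode_op F) \<le> ennreal M"
  unfolding op_norm_def
proof (rule SUP_least)
  fix u assume "u \<in> {u \<in> carrier X. vnorm X u \<le> 1}"
  then obtain x where x: "x \<in> S" "u = code x" "norm x \<le> 1" by (auto simp: X_simps)
  have "norm (F x) \<le> M * norm x" using assms x by blast
  also have "\<dots> \<le> M * 1" using x assms by (intro mult_left_mono) auto
  finally show "ennreal (vnorm X (encode_op F u)) \<le> ennreal M"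
    using x by (auto simp: X_simps encode_op_def intro: ennreal_leI)
qed

lemma bounded_operator_encode_op:
  assumes "bounded_linear F" "\<And>c x. F (cs c x) = cs c (F x)" "\<And>x. x \<in> S \<Longrightarrow> F x \<in> S"
  shows "bounded_operator X (encode_op F)"
proof -
  interpret bounded_linear F by fact
  obtain M where "0 \<le> M" "\<And>x. norm (F x) \<le> norm x * M" using nonneg_bounded by blast
  then have "op_norm X (encode_op F) \<le> ennreal M"
    by (intro op_norm_encode_op) (auto simp: mult.commute)
  then have "op_norm X (encode_op F) < \<infinity>"
    by (rule le_less_trans) simp
  then show ?thesis
    unfolding bounded_operator_def using assms(2,3) by (auto simp: X_simps encode_op_def add)
qed

lemma C0_semigroup_encode_op:
  assumes F: "\<And>t. bounded_linear (F t)" "\<And>t c x. F t (cs c x) = cs c (F t x)" "\<And>t x. x \<in> S \<Longrightarrow> F t x \<in> S"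
    and "\<And>x. F 0 x = x" "\<And>s t x. F (s + t) x = F s (F t x)"
    and "\<And>x. x \<in> S \<Longrightarrow> ((\<lambda>t. F t x) \<longlongrightarrow> x) (at_right 0)"
  shows "C0_semigroup X (\<lambda>t. encode_op (F t))"
proof -
  interpret complex_banach_space X by (rule complex_banach_space_X)
  show ?thesis
  proof
    show "bounded_operator X (encode_op (F t))" for t
      using F by (rule bounded_operator_encode_op)
    show "limitin (norm_topology X) (\<lambda>t. encode_op (F t) x) x (at_right 0)" if "x \<in> carrier X" for x
    proof -
      obtain a where a: "a \<in> S" "x = code a" using \<open>x \<in> carrier X\<close> by (auto simp: X_simps)
      have "limitin (norm_topology X) (\<lambda>t. code (F t a)) (code a) (at_right 0)"
        using a assms by (intro limitin_X) auto
      then show ?thesis by (simp add: encode_op_def a)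
    qed
  qed (auto simp: X_simps encode_op_def assms)
qed

text \<open>On an eigenvector the difference quotients of the semigroup are those of the scalar function
  \<open>h \<mapsto> cis (\<theta> * h)\<close>.\<close>

lemma eigenvector_point_spectrum:
  assumes F: "\<And>t. F t g = cs (cis (\<theta> * t)) g" and g: "g \<in> S" "g \<noteq> 0"
  shows "\<i> * of_real \<theta> \<in> point_spectrum X (generator X (\<lambda>t. encode_op (F t)))"
proof -
  have "((\<lambda>z. exp (\<i> * of_real \<theta> * z)) has_field_derivative \<i> * of_real \<theta>) (at 0)"
    by (auto intro!: derivative_eq_intros)
  then have "((\<lambda>z. (exp (\<i> * of_real \<theta> * z) - 1) / z) \<longlongrightarrow> \<i> * of_real \<theta>) (at 0)"
    by (simp add: has_field_derivative_iff)
  moreover have "filterlim (\<lambda>h. complex_of_real h) (at 0) (at_right 0)"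
    by (rule filterlim_atI) (auto intro!: tendsto_eq_intros eventually_at_rightI[of 0 1])
  ultimately have "((\<lambda>h. (exp (\<i> * of_real \<theta> * of_real h) - 1) / of_real h) \<longlongrightarrow> \<i> * of_real \<theta>) (at_right 0)"
    by (rule filterlim_compose)
  then have deriv: "((\<lambda>h. (cis (\<theta> * h) - 1) / of_real h) \<longlongrightarrow> \<i> * of_real \<theta>) (at_right 0)"
    by (simp add: cis_conv_exp mult.assoc)
  have "limitin (norm_topology X)
      (\<lambda>h. complex_of_real (1 / h) \<odot>\<^bsub>X\<^esub> (encode_op (F h) (code g) \<ominus>\<^bsub>X\<^esub> code g))
      (code (cs (\<i> * of_real \<theta>) g)) (at_right 0)"
  proof -
    have "complex_of_real (1 / h) \<odot>\<^bsub>X\<^esub> (encode_op (F h) (code g) \<ominus>\<^bsub>X\<^esub> code g) =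
        code (cs ((cis (\<theta> * h) - 1) / of_real h) g)" for h
    proof -
      have "encode_op (F h) (code g) \<ominus>\<^bsub>X\<^esub> code g = code (cs (cis (\<theta> * h) - 1) g)"
        using g by (simp add: encode_op_def F X_minus cs_S cs_diff_left)
      then show ?thesis by (simp add: X_simps cs_cs)
    qed
    moreover have "((\<lambda>h. cs ((cis (\<theta> * h) - 1) / of_real h) g) \<longlongrightarrow> cs (\<i> * of_real \<theta>) g) (at_right 0)"
      using deriv by (rule bounded_linear.tendsto[OF bounded_linear_cs_left])
    ultimately show ?thesis using g cs_S by (simp add: limitin_X)
  qed
  moreover have "code g \<noteq> \<zero>\<^bsub>X\<^esub>" using g inj_code by (auto simp: X_simps dest: injD)
  ultimately show ?thesis
    using g unfolding point_spectrum_def generator_def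
    by (auto simp: X_simps intro!: bexI[of _ "code g"])
qed

end

section \<open>The translation semigroup on the closed span of rigid characters\<close>

definition rational_values :: "(real \<Rightarrow>\<^sub>C complex) \<Rightarrow> nat \<Rightarrow> complex" where
  "rational_values f n = f (real_of_rat (from_nat n))"

lemma inj_rational_values: "inj rational_values"
proof (rule injI, rule bcontfun_eqI)
  fix f g :: "real \<Rightarrow>\<^sub>C complex" and x
  assume eq: "rational_values f = rational_values g"
  have "f (real_of_rat q) = g (real_of_rat q)" for q
    using fun_cong[OF eq, of "to_nat q"] by (simp add: rational_values_def)
  then have "\<rat> \<subseteq> {x. f x = g x}" by (auto elim!: Rats_cases)
  moreover have "closed {x. f x = g x}"
    by (intro closed_Collect_eq continuous_on_apply_bcontfun)
  ultimately have "closure \<rat> \<subseteq> {x. f x = g x}" by (rule closure_minimal)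
  then show "f x = g x" using Rats_closure_real by auto
qed

interpretation bcontfun: complex_scaling cscale
proof
  show "cscale (of_real r) f = r *\<^sub>R f" for r f
    by (rule bcontfun_eqI) (simp add: scaleR_conv_of_real)
qed (auto intro!: bcontfun_eqI simp: algebra_simps norm_cscale)

lemma weighted_translation_tendsto_id:
  assumes "f \<in> bcontfun.closed_cspan (range (weighted_character t))"
  shows "((\<lambda>h. weighted_translation t h f) \<longlongrightarrow> f) (at_right 0)"
proof (rule bcontfun.closed_cspan_tendsto_id[OF bounded_linear_weighted_translation
      weighted_translation_cscale _ _ assms])
  have "norm (weighted_translation t h f) \<le> 2 * norm f" if h: "0 < h" "h < 1" for h f
  proof -
    have "1 + oscillation t h \<le> 2" using oscillation_le_abs[of t h] h by simp
    then have "(1 + oscillation t h) * norm f \<le> 2 * norm f" by (intro mult_right_mono) auto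
    then show ?thesis using norm_weighted_translation[of t h f] by linarith
  qed
  then show "\<forall>\<^sub>F h in at_right 0. \<forall>f. norm (weighted_translation t h f) \<le> 2 * norm f"
    by (intro eventually_at_rightI[of 0 1]) auto
  fix g assume "g \<in> range (weighted_character t)"
  then obtain \<theta> where g: "g = weighted_character t \<theta>" by blast
  have "((\<lambda>h. cis (\<theta> * h)) \<longlongrightarrow> cis (\<theta> * 0)) (at_right 0)"
    by (intro tendsto_cis tendsto_intros)
  then have "((\<lambda>h. cscale (cis (\<theta> * h)) g) \<longlongrightarrow> cscale (cis (\<theta> * 0)) g) (at_right 0)"
    by (rule bounded_linear.tendsto[OF bcontfun.bounded_linear_cs_left])
  then show "((\<lambda>h. weighted_translation t h g) \<longlongrightarrow> g) (at_right 0)"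
    by (simp add: g weighted_translation_character)
qed

theorem theorem3p15:
  fixes t :: "nat \<Rightarrow> real"
  assumes "\<And>k. 0 < t k"
    and "incseq t"
    and "t 0 = 1"
    and "filterlim (\<lambda>k. t (Suc k) / t k) at_top sequentially"
  shows "\<exists>(X :: (nat \<Rightarrow> complex) normed_module) (T :: real \<Rightarrow> (nat \<Rightarrow> complex) \<Rightarrow> (nat \<Rightarrow> complex)).
           complex_banach_space X \<and>
           separable_space (norm_topology X) \<and>
           C0_semigroup X T \<and>
           (SUP k. op_norm X (T (t k))) < \<infinity> \<and>
           hausdorff_dim (point_spectrum X (generator X T) \<inter> {z. Re z = 0}) = 1"
proof -
  define G where "G = weighted_character t ` rigid_frequencies t"
  define S where "S = bcontfun.closed_cspan G"
  let ?T = "weighted_translation t"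
  interpret encoded_subspace cscale rational_values S
    by unfold_locales (auto simp: S_def intro: inj_rational_values bcontfun.subspace_closed_cspan
        bcontfun.closed_closed_cspan bcontfun.cs_closed_cspan)
  have char_S: "weighted_character t \<theta> \<in> S" if "\<theta> \<in> rigid_frequencies t" for \<theta>
    using that bcontfun.closed_cspan_superset[of G] by (auto simp: S_def G_def)
  have T_S: "?T y f \<in> S" if "f \<in> S" for y f
    using that unfolding S_def
    by (rule bcontfun.closed_cspan_invariant[OF bounded_linear_weighted_translation weighted_translation_cscale
          subspace_S[unfolded S_def] closed_S[unfolded S_def] cs_S[unfolded S_def], rotated 2])
      (auto simp: G_def weighted_translation_character intro!: cs_S[unfolded S_def G_def] char_S[unfolded S_def G_def])
  have separable: "separable_space (norm_topology X)"
  proof -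
    have "\<exists>C. countable C \<and> C \<subseteq> G \<and> (\<forall>g\<in>G. \<exists>c\<in>C. dist g c \<le> e)" if e: "0 < e" for e
    proof -
      obtain C where C: "countable C" "C \<subseteq> rigid_frequencies t"
        "\<forall>\<theta>\<in>rigid_frequencies t. \<exists>c\<in>C. rotation_size t (\<theta> - c) \<le> e"
        using rigid_frequencies_separable[OF e, of t] by blast
      show ?thesis
      proof (intro exI[of _ "weighted_character t ` C"] conjI ballI)
        fix g assume "g \<in> G"
        then obtain \<theta> where \<theta>: "\<theta> \<in> rigid_frequencies t" "g = weighted_character t \<theta>"
          by (auto simp: G_def)
        obtain c where c: "c \<in> C" "rotation_size t (\<theta> - c) \<le> e" using C(3) \<theta>(1) by blast
        then show "\<exists>d\<in>weighted_character t ` C. dist g d \<le> e"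
          unfolding \<theta>(2) using dist_weighted_character[of t \<theta> c] by (intro bexI[OF _ imageI[OF c(1)]]) linarith
      qed (use C in \<open>auto simp: G_def\<close>)
    qed
    then obtain D where "countable D" "D \<subseteq> S" "S \<subseteq> closure D"
      using bcontfun.separable_closed_cspan[of G] unfolding S_def by blast
    then show ?thesis by (rule separable_X)
  qed
  have tendsto_id: "((\<lambda>h. ?T h f) \<longlongrightarrow> f) (at_right 0)" if "f \<in> S" for f
  proof (rule weighted_translation_tendsto_id)
    have "S \<subseteq> bcontfun.closed_cspan (range (weighted_character t))"
      unfolding S_def bcontfun.closed_cspan_def G_def by (intro closure_mono span_mono) auto
    then show "f \<in> bcontfun.closed_cspan (range (weighted_character t))" using that by blast
  qed
  have semigroup: "C0_semigroup X (\<lambda>y. encode_op (?T y))"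
    by (rule C0_semigroup_encode_op[OF bounded_linear_weighted_translation weighted_translation_cscale T_S
          weighted_translation_0 weighted_translation_add tendsto_id])
  have "op_norm X (encode_op (?T (t k))) \<le> ennreal 2" for k
  proof (rule op_norm_encode_op)
    fix f :: "real \<Rightarrow>\<^sub>C complex"
    have "(1 + oscillation t (t k)) * norm f \<le> 2 * norm f"
      using oscillation_at_times[of t k] by (intro mult_right_mono) auto
    then show "norm (?T (t k) f) \<le> 2 * norm f"
      using norm_weighted_translation[of t "t k" f] by linarith
  qed simp
  then have "(SUP k. op_norm X (encode_op (?T (t k)))) \<le> ennreal 2" by (intro SUP_least)
  then have bounded: "(SUP k. op_norm X (encode_op (?T (t k)))) < \<infinity>" by (rule le_less_trans) simp
  let ?E = "point_spectrum X (generator X (\<lambda>y. encode_op (?T y))) \<inter> {z. Re z = 0}"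
  have "\<i> * of_real \<theta> \<in> ?E" if \<theta>: "\<theta> \<in> rigid_frequencies t" for \<theta>
  proof -
    have "weighted_character t \<theta> 0 \<noteq> 0" using weight_pos[of t 0] by (simp del: of_real_add)
    then have "weighted_character t \<theta> \<noteq> 0" by (metis zero_bcontfun.rep_eq)
    then show ?thesis
      using eigenvector_point_spectrum[of ?T "weighted_character t \<theta>" \<theta>,
          OF weighted_translation_character char_S[OF \<theta>]]
      by simp
  qed
  then have sub: "(\<lambda>\<theta>. \<i> * of_real \<theta>) ` rigid_frequencies t \<subseteq> ?E" by blast
  have "1 \<le> hausdorff_dim ?E"
    unfolding hausdorff_dim_def
  proof (rule Inf_greatest, clarify)
    fix s :: real assume s: "0 \<le> s" "hausdorff_measure s ?E = 0"
    then have "\<not> s < 1" using hausdorff_measure_rigid_frequencies[OF assms(1,4) s(1) _ sub] by blast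
    then show "1 \<le> ennreal s" by (simp add: ennreal_leI flip: ennreal_1)
  qed
  moreover have "hausdorff_dim ?E \<le> 1" by (rule hausdorff_dim_le_1) auto
  ultimately have "hausdorff_dim ?E = 1" by simp
  then show ?thesis using complex_banach_space_X separable semigroup bounded by blast
qed

end
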